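(* Let $(\mathcal{X},\omega)$ be a symplectic manifold with a torsion-free symplectic connection $\Gamma$ and an Ether Hamiltonian $\mathcal{H}$ (see context). Let $\{y(t)\mid 0\le t\le 1\}$ be a smooth path in $\mathcal{X}$, and let $Y=Y^t(x)$ be the solution of the Hamiltonian system $$\frac{d}{dt}Y=\frac12\,\dot y(t)\,\nabla\mathcal{H}_{y(t)}(Y)\,\Psi(Y),\qquad Y\big|_{t=0}=x,$$ that is, $\frac{d}{dt}Y^m=\frac12\,\dot y^k(t)\,\frac{\partial \mathcal{H}_{y(t)}(Y)_k}{\partial Y^j}\,\Psi^{jm}(Y)$ in local coordinates. Then $$Y^t(y(0))=y(t),\qquad dY^t(y(0))=V^t,$$ where $dY^t(y(0)):T_{y(0)}\mathcal{X}\to T_{y(t)}\mathcal{X}$ is the differential of the mapping $Y^t$ at the point $y(0)$, and $V^t$ is the parallel translation $T_{y(0)}\mathcal{X}\to T_{y(t)}\mathcal{X}$ by means of the connection $\Gamma$ along the path $\{y(\tau)\mid 0\le\tau\le t\}$.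
   Context: $\mathcal{X}$ is a smooth manifold, $\dim\mathcal{X}=2n$, with symplectic form $\omega$ and a torsion-free connection $\Gamma$ with $\nabla\omega=0$. In local coordinates $\Psi=\omega^{-1}$ is the Poisson tensor, $\omega_{kj}\Psi^{jm}=\delta^m_k$, and $\{f,g\}=\partial_jf\,\Psi^{jk}\,\partial_kg$. The Hamiltonian system of a function $f$ is $\dot z=\nabla f(z)\Psi(z)$, i.e. $\dot z^m=\partial_jf\,\Psi^{jm}$. An Ether Hamiltonian $\mathcal{H}$ is a 1-form on $\mathcal{X}$ with values in smooth real functions on $\mathcal{X}$, $\mathcal{H}_x(z)=\sum_{j=1}^{2n}\mathcal{H}_x(z)_j\,dx^j$, such that: (a) zero curvature: $\partial\mathcal{H}+\frac12\{\mathcal{H}\wedge\mathcal{H}\}=0$, i.e. $\partial_{x^j}\mathcal{H}_k-\partial_{x^k}\mathcal{H}_j+\{\mathcal{H}_j,\mathcal{H}_k\}=0$, where $\partial=d_x$ and the brackets are taken in $z$; (b) on the diagonal $z=x$: $\mathcal{H}=0$, $\nabla\mathcal{H}=2\omega$ (i.e. $\nabla_j\mathcal{H}_k=2\omega_{kj}$), $\nabla\nabla\mathcal{H}=0$, where $\nabla=\nabla_z$ is the covariant derivative in $z$; (c) $\mathcal{H}_x(s_x(z))=-\mathcal{H}_x(z)$, where $s=s_x(z)$ is the solution of $\partial s=\nabla\mathcal{H}(s)\Psi(s)$, $s|_{x=z}=z$ (here $\partial=d_x$ and $x$ plays the role of time). All Hamiltonian systems used are assumed to have solutions on the time interval considered.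 *)

theory Defs
  imports "HOL-Analysis.Analysis"
begin

primrec Ck_on :: "nat \<Rightarrow> 'a::real_normed_vector set \<Rightarrow> ('a \<Rightarrow> 'b::real_normed_vector) \<Rightarrow> bool" where
  "Ck_on 0 S f \<longleftrightarrow> continuous_on S f"
| "Ck_on (Suc k) S f \<longleftrightarrow>
     (\<forall>x\<in>S. f differentiable (at x)) \<and> (\<forall>v. Ck_on k S (\<lambda>x. frechet_derivative f (at x) v))"

text \<open>Used for open \<open>S\<close> in finite-dimensional spaces only, where this is the usual
  \<open>C\<close>-infinity smoothness.\<close>
definition smooth_on :: "'a::real_normed_vector set \<Rightarrow> ('a \<Rightarrow> 'b::real_normed_vector) \<Rightarrow> bool" where
  "smooth_on S f \<longleftrightarrow> (\<forall>k. Ck_on k S f)"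


text \<open>The underlying space is a whole (Hausdorff, second countable) type \<open>'m\<close>; its dimension is
  \<open>CARD('d)\<close>. A chart is a pair of its domain and its coordinate map; the values of the coordinate
  map outside the domain are irrelevant.\<close>
type_synonym ('m, 'd) chart = "'m set \<times> ('m \<Rightarrow> real ^ 'd)"

abbreviation chart_dom :: "('m, 'd) chart \<Rightarrow> 'm set" where
  "chart_dom c \<equiv> fst c"

abbreviation coords :: "('m, 'd) chart \<Rightarrow> 'm \<Rightarrow> real ^ 'd" where
  "coords c \<equiv> snd c"

definition chart_img :: "('m, 'd) chart \<Rightarrow> (real ^ 'd) set" where
  "chart_img c = coords c ` chart_dom c"

definition chart_inv :: "('m, 'd) chart \<Rightarrow> real ^ 'd \<Rightarrow> 'm" where
  "chart_inv c = inv_into (chart_dom c) (coords c)"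

definition is_chart :: "('m::topological_space, 'd::finite) chart \<Rightarrow> bool" where
  "is_chart c \<longleftrightarrow> open (chart_dom c) \<and> open (chart_img c) \<and>
     homeomorphism (chart_dom c) (chart_img c) (coords c) (chart_inv c)"

definition smooth_atlas :: "('m::{t2_space,second_countable_topology}, 'd::finite) chart set \<Rightarrow> bool" where
  "smooth_atlas A \<longleftrightarrow>
     (\<forall>c\<in>A. is_chart c) \<and> (\<Union>c\<in>A. chart_dom c) = UNIV \<and>
     (\<forall>c\<in>A. \<forall>c'\<in>A. smooth_on (coords c ` (chart_dom c \<inter> chart_dom c')) (coords c' \<circ> chart_inv c))"

definition smooth_in :: "('m, 'd::finite) chart \<Rightarrow> ('m \<Rightarrow> real) \<Rightarrow> bool" where
  "smooth_in c f \<longleftrightarrow> smooth_on (chart_img c) (f \<circ> chart_inv c)"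

text \<open>\<open>coord_deriv c j f p\<close> is the partial derivative of \<open>f\<close> at \<open>p\<close> with respect to the
  \<open>j\<close>-th coordinate of \<open>c\<close>.\<close>
definition coord_deriv :: "('m, 'd::finite) chart \<Rightarrow> 'd \<Rightarrow> ('m \<Rightarrow> real) \<Rightarrow> 'm \<Rightarrow> real" where
  "coord_deriv c j f p = frechet_derivative (f \<circ> chart_inv c) (at (coords c p)) (axis j 1)"

text \<open>Row index: coordinate of \<open>c'\<close>; column index: coordinate of \<open>c\<close>.\<close>
definition jacobian :: "('m, 'd::finite) chart \<Rightarrow> ('m, 'd) chart \<Rightarrow> 'm \<Rightarrow> real ^ 'd ^ 'd" where
  "jacobian c c' p = (\<chi> m k. coord_deriv c k (\<lambda>q. coords c' q $ m) p)"

text \<open>A tangent vector at \<open>p\<close> is the family of its components in the charts around \<open>p\<close>, related by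
  the transformation law; it is set to \<open>0\<close> at all other charts so that equality of tangent vectors
  is equality of functions.\<close>
type_synonym ('m, 'd) tvec = "('m, 'd) chart \<Rightarrow> real ^ 'd"

definition tangent_space :: "('m, 'd::finite) chart set \<Rightarrow> 'm \<Rightarrow> ('m, 'd) tvec set" where
  "tangent_space A p = {v.
     (\<forall>c\<in>A. \<forall>c'\<in>A. p \<in> chart_dom c \<inter> chart_dom c' \<longrightarrow> v c' = jacobian c c' p *v v c) \<and>
     (\<forall>c. c \<notin> A \<or> p \<notin> chart_dom c \<longrightarrow> v c = 0)}"

definition map_differentiable_at ::
  "('m::t2_space, 'd::finite) chart set \<Rightarrow> ('m \<Rightarrow> 'm) \<Rightarrow> 'm \<Rightarrow> bool" where
  "map_differentiable_at A F p \<longleftrightarrow> isCont F p \<and>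
     (\<forall>c\<in>A. \<forall>c'\<in>A. p \<in> chart_dom c \<longrightarrow> F p \<in> chart_dom c' \<longrightarrow>
        (coords c' \<circ> F \<circ> chart_inv c) differentiable (at (coords c p)))"

text \<open>By the chain rule the result does not depend on the chart chosen around \<open>p\<close>.\<close>
definition differential ::
  "('m, 'd::finite) chart set \<Rightarrow> ('m \<Rightarrow> 'm) \<Rightarrow> 'm \<Rightarrow> ('m, 'd) tvec \<Rightarrow> ('m, 'd) tvec" where
  "differential A F p v = (\<lambda>c'.
     if c' \<in> A \<and> F p \<in> chart_dom c'
     then let c = (SOME c. c \<in> A \<and> p \<in> chart_dom c) in
       frechet_derivative (coords c' \<circ> F \<circ> chart_inv c) (at (coords c p)) (v c)
     else 0)"

text \<open>Smoothness on the closed interval \<open>[0,1]\<close>: locally \<open>y\<close> is the restriction of a smooth map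
  defined on an open interval.\<close>
definition smooth_path :: "('m, 'd::finite) chart set \<Rightarrow> (real \<Rightarrow> 'm) \<Rightarrow> bool" where
  "smooth_path A y \<longleftrightarrow>
     (\<forall>t\<in>{0..1}. \<forall>c\<in>A. y t \<in> chart_dom c \<longrightarrow>
        (\<exists>\<delta>>0. \<exists>g. smooth_on {t - \<delta><..<t + \<delta>} g \<and>
           (\<forall>\<tau>\<in>{t - \<delta><..<t + \<delta>} \<inter> {0..1}. y \<tau> \<in> chart_dom c \<and> coords c (y \<tau>) = g \<tau>)))"

definition velocity :: "('m, 'd::finite) chart \<Rightarrow> (real \<Rightarrow> 'm) \<Rightarrow> real \<Rightarrow> real ^ 'd" where
  "velocity c y t = vector_derivative (coords c \<circ> y) (at t within {0..1})"


text \<open>Tensor fields and connections are given by their components in each chart of the atlas,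
  subject to the transformation laws: \<open>\<omega> c p $ j $ k\<close> are the components of \<open>\<omega>\<close> at \<open>p\<close>
  in the chart \<open>c\<close>.\<close>
type_synonym ('m, 'd) tensor2 = "('m, 'd) chart \<Rightarrow> 'm \<Rightarrow> real ^ 'd ^ 'd"

definition symplectic_form :: "('m, 'd::finite) chart set \<Rightarrow> ('m, 'd) tensor2 \<Rightarrow> bool" where
  "symplectic_form A \<omega> \<longleftrightarrow>
     (\<forall>c\<in>A. \<forall>j k. smooth_in c (\<lambda>p. \<omega> c p $ j $ k)) \<and>
     (\<forall>c\<in>A. \<forall>c'\<in>A. \<forall>p\<in>chart_dom c \<inter> chart_dom c'. \<forall>j k.
        \<omega> c p $ j $ k =
          (\<Sum>a\<in>UNIV. \<Sum>b\<in>UNIV. \<omega> c' p $ a $ b * jacobian c c' p $ a $ j * jacobian c c' p $ b $ k)) \<and>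
     (\<forall>c\<in>A. \<forall>p\<in>chart_dom c. \<forall>j k. \<omega> c p $ j $ k = - \<omega> c p $ k $ j) \<and>
     (\<forall>c\<in>A. \<forall>p\<in>chart_dom c. invertible (\<omega> c p)) \<and>
     (\<forall>c\<in>A. \<forall>p\<in>chart_dom c. \<forall>i j k.
        coord_deriv c i (\<lambda>q. \<omega> c q $ j $ k) p + coord_deriv c j (\<lambda>q. \<omega> c q $ k $ i) p
          + coord_deriv c k (\<lambda>q. \<omega> c q $ i $ j) p = 0)"

definition poisson_tensor :: "('m, 'd::finite) tensor2 \<Rightarrow> ('m, 'd) tensor2" where
  "poisson_tensor \<omega> c p = matrix_inv (\<omega> c p)"

definition poisson_bracket ::
  "('m, 'd::finite) tensor2 \<Rightarrow> ('m, 'd) chart \<Rightarrow> ('m \<Rightarrow> real) \<Rightarrow> ('m \<Rightarrow> real) \<Rightarrow> 'm \<Rightarrow> real" where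
  "poisson_bracket \<omega> c f g p =
     (\<Sum>j\<in>UNIV. \<Sum>k\<in>UNIV. coord_deriv c j f p * poisson_tensor \<omega> c p $ j $ k * coord_deriv c k g p)"

text \<open>\<open>\<Gamma> c p m i j\<close> is the Christoffel symbol with upper index \<open>m\<close> and lower indices \<open>i j\<close>,
  where the derivative of the \<open>j\<close>-th coordinate field in direction \<open>i\<close> is
  \<open>\<Sum>m. \<Gamma> c p m i j\<close> times the \<open>m\<close>-th coordinate field.\<close>
type_synonym ('m, 'd) christoffel = "('m, 'd) chart \<Rightarrow> 'm \<Rightarrow> 'd \<Rightarrow> 'd \<Rightarrow> 'd \<Rightarrow> real"

definition affine_connection :: "('m, 'd::finite) chart set \<Rightarrow> ('m, 'd) christoffel \<Rightarrow> bool" where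
  "affine_connection A \<Gamma> \<longleftrightarrow>
     (\<forall>c\<in>A. \<forall>m i j. smooth_in c (\<lambda>p. \<Gamma> c p m i j)) \<and>
     (\<forall>c\<in>A. \<forall>c'\<in>A. \<forall>p\<in>chart_dom c \<inter> chart_dom c'. \<forall>m i j.
        (\<Sum>k\<in>UNIV. jacobian c c' p $ m $ k * \<Gamma> c p k i j) =
          coord_deriv c i (\<lambda>q. coord_deriv c j (\<lambda>r. coords c' r $ m) q) p +
          (\<Sum>a\<in>UNIV. \<Sum>b\<in>UNIV. \<Gamma> c' p m a b * jacobian c c' p $ a $ i * jacobian c c' p $ b $ j))"

definition torsion_free :: "('m, 'd::finite) chart set \<Rightarrow> ('m, 'd) christoffel \<Rightarrow> bool" where
  "torsion_free A \<Gamma> \<longleftrightarrow> (\<forall>c\<in>A. \<forall>p\<in>chart_dom c. \<forall>m i j. \<Gamma> c p m i j = \<Gamma> c p m j i)"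

definition parallel_form ::
  "('m, 'd::finite) chart set \<Rightarrow> ('m, 'd) christoffel \<Rightarrow> ('m, 'd) tensor2 \<Rightarrow> bool" where
  "parallel_form A \<Gamma> \<omega> \<longleftrightarrow>
     (\<forall>c\<in>A. \<forall>p\<in>chart_dom c. \<forall>i j k.
        coord_deriv c i (\<lambda>q. \<omega> c q $ j $ k) p
          - (\<Sum>l\<in>UNIV. \<Gamma> c p l i j * \<omega> c p $ l $ k)
          - (\<Sum>l\<in>UNIV. \<Gamma> c p l i k * \<omega> c p $ j $ l) = 0)"

definition cov_deriv2 ::
  "('m, 'd::finite) christoffel \<Rightarrow> ('m, 'd) chart \<Rightarrow> 'd \<Rightarrow> 'd \<Rightarrow> ('m \<Rightarrow> real) \<Rightarrow> 'm \<Rightarrow> real" where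
  "cov_deriv2 \<Gamma> c i j f p =
     coord_deriv c i (\<lambda>q. coord_deriv c j f q) p - (\<Sum>l\<in>UNIV. \<Gamma> c p l i j * coord_deriv c l f p)"

definition parallel_along ::
  "('m, 'd::finite) chart set \<Rightarrow> ('m, 'd) christoffel \<Rightarrow> (real \<Rightarrow> 'm) \<Rightarrow> real \<Rightarrow> (real \<Rightarrow> ('m, 'd) tvec) \<Rightarrow> bool"
  where
  "parallel_along A \<Gamma> y t W \<longleftrightarrow>
     (\<forall>\<tau>\<in>{0..t}. W \<tau> \<in> tangent_space A (y \<tau>)) \<and>
     (\<forall>\<tau>\<in>{0..t}. \<forall>c\<in>A. y \<tau> \<in> chart_dom c \<longrightarrow>
        ((\<lambda>\<sigma>. W \<sigma> c) has_vector_derivative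
           (\<chi> m. - (\<Sum>i\<in>UNIV. \<Sum>j\<in>UNIV. \<Gamma> c (y \<tau>) m i j * velocity c y \<tau> $ i * W \<tau> c $ j)))
        (at \<tau> within {0..t}))"

definition parallel_translation ::
  "('m, 'd::finite) chart set \<Rightarrow> ('m, 'd) christoffel \<Rightarrow> (real \<Rightarrow> 'm) \<Rightarrow> real \<Rightarrow> ('m, 'd) tvec \<Rightarrow> ('m, 'd) tvec"
  where
  "parallel_translation A \<Gamma> y t v = (THE w. \<exists>W. parallel_along A \<Gamma> y t W \<and> W 0 = v \<and> W t = w)"


text \<open>\<open>H c x z $ k\<close> is the \<open>k\<close>-th component, in the chart \<open>c\<close> around \<open>x\<close>, of the value at \<open>x\<close> of
  a 1-form with values in functions of \<open>z\<close>.\<close>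
type_synonym ('m, 'd) fun_form = "('m, 'd) chart \<Rightarrow> 'm \<Rightarrow> 'm \<Rightarrow> real ^ 'd"

definition smooth_fun_form :: "('m, 'd::finite) chart set \<Rightarrow> ('m, 'd) fun_form \<Rightarrow> bool" where
  "smooth_fun_form A H \<longleftrightarrow>
     (\<forall>c\<in>A. \<forall>c'\<in>A. \<forall>x\<in>chart_dom c \<inter> chart_dom c'. \<forall>z k.
        H c x z $ k = (\<Sum>a\<in>UNIV. H c' x z $ a * jacobian c c' x $ a $ k)) \<and>
     (\<forall>c\<in>A. \<forall>c'\<in>A. smooth_on (chart_img c \<times> chart_img c') (\<lambda>(u, v). H c (chart_inv c u) (chart_inv c' v)))"

text \<open>The right-hand side of the Hamiltonian system (in the variable \<open>z\<close>, in the chart \<open>c'\<close>) of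
  the function \<open>\<Sum>k. \<xi> $ k * H c x z $ k\<close>, the value of the form on the tangent vector at \<open>x\<close>
  with components \<open>\<xi>\<close> in the chart \<open>c\<close>.\<close>
definition ether_field ::
  "('m, 'd::finite) tensor2 \<Rightarrow> ('m, 'd) fun_form \<Rightarrow> ('m, 'd) chart \<Rightarrow> 'm \<Rightarrow> real ^ 'd
     \<Rightarrow> ('m, 'd) chart \<Rightarrow> 'm \<Rightarrow> real ^ 'd" where
  "ether_field \<omega> H c x \<xi> c' z =
     (\<chi> m. \<Sum>k\<in>UNIV. \<Sum>j\<in>UNIV.
        \<xi> $ k * coord_deriv c' j (\<lambda>w. H c x w $ k) z * poisson_tensor \<omega> c' z $ j $ m)"

text \<open>\<open>s x z\<close> solves \<open>\<partial>s = \<nabla>H(s) \<Psi>(s)\<close>, \<open>s = z\<close> at \<open>x = z\<close>; the multidimensional time is \<open>x\<close>.\<close>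
definition ether_solution ::
  "('m::topological_space, 'd::finite) chart set \<Rightarrow> ('m, 'd) tensor2 \<Rightarrow> ('m, 'd) fun_form
     \<Rightarrow> ('m \<Rightarrow> 'm \<Rightarrow> 'm) \<Rightarrow> bool" where
  "ether_solution A \<omega> H s \<longleftrightarrow>
     (\<forall>z. s z z = z) \<and>
     (\<forall>z. continuous_on UNIV (\<lambda>x. s x z)) \<and>
     (\<forall>x z. \<forall>c\<in>A. \<forall>c'\<in>A. x \<in> chart_dom c \<longrightarrow> s x z \<in> chart_dom c' \<longrightarrow>
        ((\<lambda>u. coords c' (s (chart_inv c u) z)) has_derivative
           (\<lambda>\<xi>. ether_field \<omega> H c x \<xi> c' (s x z))) (at (coords c x)))"

definition zero_curvature ::
  "('m, 'd::finite) chart set \<Rightarrow> ('m, 'd) tensor2 \<Rightarrow> ('m, 'd) fun_form \<Rightarrow> bool" where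
  "zero_curvature A \<omega> H \<longleftrightarrow>
     (\<forall>c\<in>A. \<forall>c'\<in>A. \<forall>x\<in>chart_dom c. \<forall>z\<in>chart_dom c'. \<forall>j k.
        coord_deriv c j (\<lambda>q. H c q z $ k) x - coord_deriv c k (\<lambda>q. H c q z $ j) x
          + poisson_bracket \<omega> c' (\<lambda>w. H c x w $ j) (\<lambda>w. H c x w $ k) z = 0)"

definition diagonal_conditions ::
  "('m, 'd::finite) chart set \<Rightarrow> ('m, 'd) tensor2 \<Rightarrow> ('m, 'd) christoffel \<Rightarrow> ('m, 'd) fun_form \<Rightarrow> bool"
  where
  "diagonal_conditions A \<omega> \<Gamma> H \<longleftrightarrow>
     (\<forall>c\<in>A. \<forall>x\<in>chart_dom c.
        H c x x = 0 \<and>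
        (\<forall>j k. coord_deriv c j (\<lambda>z. H c x z $ k) x = 2 * \<omega> c x $ k $ j) \<and>
        (\<forall>i j k. cov_deriv2 \<Gamma> c i j (\<lambda>z. H c x z $ k) x = 0))"

definition ether_hamiltonian ::
  "('m::topological_space, 'd::finite) chart set \<Rightarrow> ('m, 'd) tensor2 \<Rightarrow> ('m, 'd) christoffel
     \<Rightarrow> ('m, 'd) fun_form \<Rightarrow> bool" where
  "ether_hamiltonian A \<omega> \<Gamma> H \<longleftrightarrow>
     smooth_fun_form A H \<and> zero_curvature A \<omega> H \<and> diagonal_conditions A \<omega> \<Gamma> H \<and>
     (\<exists>s. ether_solution A \<omega> H s \<and>
        (\<forall>c\<in>A. \<forall>x\<in>chart_dom c. \<forall>z. H c x (s x z) = - H c x z))"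

definition translation_flow ::
  "('m::topological_space, 'd::finite) chart set \<Rightarrow> ('m, 'd) tensor2 \<Rightarrow> ('m, 'd) fun_form
     \<Rightarrow> (real \<Rightarrow> 'm) \<Rightarrow> (real \<Rightarrow> 'm \<Rightarrow> 'm) \<Rightarrow> bool" where
  "translation_flow A \<omega> H y Y \<longleftrightarrow>
     (\<forall>x. Y 0 x = x) \<and>
     (\<forall>x. continuous_on {0..1} (\<lambda>t. Y t x)) \<and>
     (\<forall>x. \<forall>t\<in>{0..1}. \<forall>c\<in>A. \<forall>c'\<in>A. y t \<in> chart_dom c \<longrightarrow> Y t x \<in> chart_dom c' \<longrightarrow>
        ((\<lambda>\<tau>. coords c' (Y \<tau> x)) has_vector_derivative
           ether_field \<omega> H c (y t) ((1/2) *\<^sub>R velocity c y t) c' (Y t x)) (at t within {0..1}))"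

end

theory Submission
  imports Defs
begin

text \<open>
  \<^bold>\<open>Why the path is a trajectory.\<close> Contracting the form with half the velocity of \<open>y\<close> gives the
  Hamiltonian \<open>(1/2) \<xi>\<^sup>k H\<^sub>k\<close>, where \<open>\<xi>\<close> is the velocity. On the diagonal its differential is
  \<open>\<xi>\<^sup>k \<omega>\<^sub>k\<^sub>j\<close>, so that its Hamiltonian vector field at the point \<open>y t\<close> is \<open>\<xi>\<close> itself, and \<open>y\<close> solves
  the system. Solutions being unique, \<open>Y t (y 0) = y t\<close>.

  \<^bold>\<open>Why the differential is the parallel translation.\<close> The differential of a flow along a
  trajectory solves the linearised system, so only the derivative of the field at \<open>y t\<close> matters.
  There the second derivatives of \<open>H\<close> are expressed by \<open>\<Gamma>\<close> and \<open>\<omega>\<close>, because the second covariant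
  derivative vanishes on the diagonal, and the derivatives of the Poisson tensor are expressed by
  \<open>\<Gamma>\<close> and \<open>\<omega>\<close>, because \<open>\<omega>\<close> is parallel. One of the two terms coming from the derivative of \<open>\<omega>\<close>
  cancels the one coming from \<open>H\<close>; the other one is \<open>- \<Gamma> (\<xi>, w)\<close>, which is the
  right-hand side of the equation of parallel translation (\<open>ether_field_linearisation\<close>).

  \<^bold>\<open>How this becomes a proof.\<close> The flow is only known through its individual trajectories, so the
  differentiability in the initial point has to be proved along with the formula. On a short piece
  of the path lying in one chart, a trajectory starting near the path stays in a tube around it
  (\<open>stays_in_tube\<close>), and comparison with the solution of the linear equation
  (\<open>fundamental_solution\<close>) by Gronwall's inequality shows that the deviation from the path is
  transported linearly up to an error of higher order (\<open>linearisation_error\<close>,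
  \<open>flow_linearisation\<close>). The exact solution and the neighbouring ones are treated alike: a
  trajectory with zero initial deviation keeps zero deviation. The pieces are joined by
  subdividing the interval (\<open>tracks_everywhere\<close>). Since the local statement holds in every chart
  around a point of the path, the equation of parallel translation is obtained in all charts
  without transforming Christoffel symbols. Finally, a parallel field is determined by its
  initial value (\<open>parallel_along_unique\<close>).
\<close>

section \<open>Linear differential equations and perturbations\<close>

text \<open>Gronwall's inequality for a vector function. The squared norm is used instead of the norm
  because it is differentiable at zeros of \<open>u\<close>, and \<open>e\<^sup>2\<close> is added to it so that the inhomogeneous
  term is absorbed into a homogeneous inequality.\<close>
lemma gronwall_norm_bound:
  fixes u u' :: "real \<Rightarrow> 'a::real_inner"
  assumes K: "0 \<le> K" and e: "0 \<le> e"
    and deriv: "\<And>t. t \<in> {a..b} \<Longrightarrow> (u has_vector_derivative u' t) (at t within {a..b})"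
    and bound: "\<And>t. t \<in> {a..b} \<Longrightarrow> norm (u' t) \<le> K * norm (u t) + e"
    and t: "t \<in> {a..b}"
  shows "norm (u t) \<le> exp ((2 * K + 1) * (b - a)) * (norm (u a) + e)"
proof -
  \<comment> \<open>\<open>2 * K\<close> comes from differentiating the square, the summand 1 from \<open>2 n e \<le> n\<^sup>2 + e\<^sup>2\<close>\<close>
  define L where "L = 2 * K + 1"
  define \<phi> where "\<phi> s = (u s \<bullet> u s + e\<^sup>2) * exp (- L * (s - a))" for s
  have cont: "continuous_on {a..b} u"
    using deriv by (meson continuous_on_vector_derivative)
  have "\<phi> t \<le> \<phi> a"
  proof (rule DERIV_nonpos_imp_decreasing_open[where f = \<phi>])
    show "a \<le> t" using t by simp
    show "continuous_on {a..t} \<phi>"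
      unfolding \<phi>_def using t by (intro continuous_intros continuous_on_subset[OF cont]) auto
    fix s assume s: "a < s" "s < t"
    have "(u has_vector_derivative u' s) (at s)"
      using deriv[of s] s t by (simp add: at_within_Icc_at)
    then have "(u has_derivative (\<lambda>h. h *\<^sub>R u' s)) (at s)"
      by (simp add: has_vector_derivative_def)
    then have "((\<lambda>s. u s \<bullet> u s) has_derivative (\<lambda>h. h * (2 * (u s \<bullet> u' s)))) (at s)"
      by (auto intro!: derivative_eq_intros simp: inner_commute algebra_simps)
    then have [derivative_intros]: "((\<lambda>s. u s \<bullet> u s) has_real_derivative 2 * (u s \<bullet> u' s)) (at s)"
      by (simp add: has_field_derivative_def mult.commute[of "2 * _"] mult_commute_abs)
    have "(\<phi> has_real_derivative (2 * (u s \<bullet> u' s) - L * (u s \<bullet> u s + e\<^sup>2)) * exp (- L * (s - a))) (at s)"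
      unfolding \<phi>_def by (auto intro!: derivative_eq_intros simp: algebra_simps)
    moreover have "2 * (u s \<bullet> u' s) - L * (u s \<bullet> u s + e\<^sup>2) \<le> 0"
    proof -
      define n where "n = norm (u s)"
      have "u s \<bullet> u' s \<le> n * norm (u' s)" unfolding n_def by (rule norm_cauchy_schwarz)
      also have "\<dots> \<le> n * (K * n + e)"
        unfolding n_def using bound[of s] s t by (intro mult_left_mono) auto
      finally have "2 * (u s \<bullet> u' s) \<le> 2 * K * n\<^sup>2 + 2 * n * e"
        by (simp add: power2_eq_square algebra_simps)
      also have "\<dots> \<le> 2 * K * n\<^sup>2 + (n\<^sup>2 + e\<^sup>2)" by (simp add: sum_squares_bound)
      also have "\<dots> \<le> L * (n\<^sup>2 + e\<^sup>2)" using K by (simp add: L_def algebra_simps)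
      finally show ?thesis by (simp add: n_def power2_norm_eq_inner)
    qed
    ultimately show "\<exists>y. (\<phi> has_real_derivative y) (at s) \<and> y \<le> 0"
      by (meson exp_ge_zero mult_nonpos_nonneg)
  qed
  then have "(norm (u t))\<^sup>2 + e\<^sup>2 \<le> ((norm (u a))\<^sup>2 + e\<^sup>2) * exp (L * (t - a))"
  proof -
    have "\<phi> t * exp (L * (t - a)) \<le> \<phi> a * exp (L * (t - a))"
      using \<open>\<phi> t \<le> \<phi> a\<close> by (intro mult_right_mono) auto
    moreover have "\<phi> t * exp (L * (t - a)) = u t \<bullet> u t + e\<^sup>2"
      by (simp add: \<phi>_def mult.assoc flip: exp_add)
    moreover have "\<phi> a = u a \<bullet> u a + e\<^sup>2" by (simp add: \<phi>_def)
    ultimately show ?thesis by (simp only: power2_norm_eq_inner)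
  qed
  then have "(norm (u t))\<^sup>2 \<le> ((norm (u a))\<^sup>2 + e\<^sup>2) * exp (L * (t - a))"
    by (smt (verit) zero_le_power2)
  also have "\<dots> \<le> (norm (u a) + e)\<^sup>2 * (exp (L * (b - a)))\<^sup>2"
  proof (rule mult_mono)
    show "(norm (u a))\<^sup>2 + e\<^sup>2 \<le> (norm (u a) + e)\<^sup>2" using e by (simp add: power2_sum)
    have "exp (L * (t - a)) \<le> exp (L * (b - a))" using t K by (simp add: L_def)
    also have "\<dots> \<le> (exp (L * (b - a)))\<^sup>2"
      using t K by (intro self_le_power) (auto simp: L_def)
    finally show "exp (L * (t - a)) \<le> (exp (L * (b - a)))\<^sup>2" .
  qed auto
  also have "\<dots> = (exp (L * (b - a)) * (norm (u a) + e))\<^sup>2" by (simp add: power_mult_distrib)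
  finally show ?thesis
    using e unfolding L_def by (intro power2_le_imp_le[of "norm (u t)"]) auto
qed

text \<open>The fundamental solution of a linear equation is a fixed point of the Picard operator. On a short
  interval this operator is a contraction for the supremum norm; a short interval suffices
  because the flow is studied on small pieces of the path.\<close>
lemma fundamental_solution:
  fixes B :: "real \<Rightarrow> 'a::banach \<Rightarrow>\<^sub>L 'a"
  assumes ab: "a \<le> b" and B: "continuous_on {a..b} B"
    and K: "\<And>t. t \<in> {a..b} \<Longrightarrow> norm (B t) \<le> K" and short: "K * (b - a) \<le> 1 / 2"
  obtains M where "M a = id_blinfun"
    and "\<And>t. t \<in> {a..b} \<Longrightarrow> (M has_vector_derivative (B t o\<^sub>L M t)) (at t within {a..b})"
proof -
  define I :: "(real \<Rightarrow>\<^sub>C ('a \<Rightarrow>\<^sub>L 'a)) \<Rightarrow> real \<Rightarrow> 'a \<Rightarrow>\<^sub>L 'a"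
    where "I w t = id_blinfun + integral {a..t} (\<lambda>s. B s o\<^sub>L apply_bcontfun w s)" for w t
  have intg_cont: "continuous_on {a..b} (\<lambda>s. B s o\<^sub>L apply_bcontfun w s)" for w
    by (intro continuous_intros B continuous_on_subset[OF continuous_on_apply_bcontfun]) auto
  have I_deriv: "(I w has_vector_derivative B t o\<^sub>L apply_bcontfun w t) (at t within {a..b})"
    if "t \<in> {a..b}" for w t
    unfolding I_def using integral_has_vector_derivative[OF intg_cont that]
    by (auto intro!: derivative_eq_intros)
  have I_cont: "continuous_on (cbox a b) (I w)" for w
    unfolding cbox_interval by (rule continuous_on_vector_derivative) (rule I_deriv)
  \<comment> \<open>clamping extends a function on \<open>{a..b}\<close> to the line, where bounded continuous functions form a complete space\<close>
  have "\<exists>h. \<forall>t. apply_bcontfun h t = I w (clamp a b t)" for w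
    by (rule continuous_on_cbox_bcontfunE[OF I_cont[of w]]) auto
  then obtain P where P: "\<And>w t. apply_bcontfun (P w) t = I w (clamp a b t)" by metis
  have "dist (P v) (P w) \<le> 1 / 2 * dist v w" for v w
  proof (rule dist_bound)
    fix t
    define t' where "t' = clamp a b t"
    have t': "t' \<in> {a..b}" unfolding t'_def using clamp_in_interval[of a b t] ab by simp
    have K0: "0 \<le> K" using order_trans[OF norm_ge_zero K[of a]] ab by simp
    have sub: "{a..t'} \<subseteq> {a..b}" using t' by auto
    have int: "(\<lambda>s. B s o\<^sub>L apply_bcontfun w s) integrable_on {a..t'}"
      for w :: "real \<Rightarrow>\<^sub>C ('a \<Rightarrow>\<^sub>L 'a)"
      by (rule integrable_continuous_interval) (rule continuous_on_subset[OF intg_cont sub])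
    have "integral {a..t'} (\<lambda>s. (B s o\<^sub>L apply_bcontfun v s) - (B s o\<^sub>L apply_bcontfun w s))
        = integral {a..t'} (\<lambda>s. B s o\<^sub>L apply_bcontfun v s) - integral {a..t'} (\<lambda>s. B s o\<^sub>L apply_bcontfun w s)"
      using Henstock_Kurzweil_Integration.integral_diff[OF int[of v] int[of w]] .
    then have "dist (apply_bcontfun (P v) t) (apply_bcontfun (P w) t)
        = norm (integral {a..t'} (\<lambda>s. (B s o\<^sub>L apply_bcontfun v s) - (B s o\<^sub>L apply_bcontfun w s)))"
      by (simp add: P t'_def[symmetric] I_def dist_norm)
    also have "\<dots> \<le> K * dist v w * (t' - a)"
    proof (rule integral_bound)
      show "a \<le> t'" using t' by simp
      show "continuous_on {a..t'} (\<lambda>s. (B s o\<^sub>L apply_bcontfun v s) - (B s o\<^sub>L apply_bcontfun w s))"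
        by (intro continuous_on_diff continuous_on_subset[OF intg_cont sub])
      fix s assume "s \<in> {a..t'}"
      then have s: "s \<in> {a..b}" using sub by auto
      have "norm ((B s o\<^sub>L apply_bcontfun v s) - (B s o\<^sub>L apply_bcontfun w s))
          = norm (B s o\<^sub>L (apply_bcontfun v s - apply_bcontfun w s))"
        by (simp add: bounded_bilinear.diff_right[OF bounded_bilinear_blinfun_compose])
      also have "\<dots> \<le> norm (B s) * dist (apply_bcontfun v s) (apply_bcontfun w s)"
        by (simp add: dist_norm norm_blinfun_compose)
      also have "\<dots> \<le> K * dist v w"
        using K[OF s] K0 dist_bounded[of v s w] by (intro mult_mono) auto
      finally show "norm ((B s o\<^sub>L apply_bcontfun v s) - (B s o\<^sub>L apply_bcontfun w s)) \<le> K * dist v w" .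
    qed
    also have "\<dots> \<le> K * dist v w * (b - a)"
      using t' K0 by (intro mult_left_mono) auto
    also have "\<dots> = (K * (b - a)) * dist v w" by simp
    also have "\<dots> \<le> 1 / 2 * dist v w" by (rule mult_right_mono[OF short]) simp
    finally show "dist (apply_bcontfun (P v) t) (apply_bcontfun (P w) t) \<le> 1 / 2 * dist v w" .
  qed
  then obtain w where w: "P w = w"
    using banach_fix_type[of "1/2" P] by auto
  have w_eq: "apply_bcontfun w t = I w t" if "t \<in> {a..b}" for t
    using P[of w t] w that by simp
  show thesis
  proof
    show "apply_bcontfun w a = id_blinfun"
      using w_eq[of a] ab by (simp add: I_def)
    show "(apply_bcontfun w has_vector_derivative (B t o\<^sub>L apply_bcontfun w t)) (at t within {a..b})"
      if "t \<in> {a..b}" for t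
      using I_deriv[OF that, of w] by (rule has_vector_derivative_transform[OF that, rotated]) (rule w_eq)
  qed
qed

text \<open>If \<open>u\<close> obeys the linearised equation around \<open>g\<close> up to a relative error \<open>\<epsilon>\<close>, the difference
  \<open>u - g\<close> and the linear prediction from its initial value satisfy equations that differ by a
  term of size \<open>\<epsilon>\<close> times \<open>norm (u - g)\<close>. Gronwall's inequality is used twice: for \<open>u - g\<close>,
  which controls this term, and then for the discrepancy, which starts at zero.\<close>
lemma linearisation_error:
  fixes g u :: "real \<Rightarrow> 'a::{real_inner, banach}"
  assumes ab: "a \<le> b" and K: "0 \<le> K" and \<epsilon>: "0 \<le> \<epsilon>"
    and B: "\<And>t. t \<in> {a..b} \<Longrightarrow> norm (B t) \<le> K"
    and M0: "M a = id_blinfun"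
    and M: "\<And>t. t \<in> {a..b} \<Longrightarrow> (M has_vector_derivative (B t o\<^sub>L M t)) (at t within {a..b})"
    and g: "\<And>t. t \<in> {a..b} \<Longrightarrow> (g has_vector_derivative g' t) (at t within {a..b})"
    and u: "\<And>t. t \<in> {a..b} \<Longrightarrow> (u has_vector_derivative u' t) (at t within {a..b})"
    and lin: "\<And>t. t \<in> {a..b} \<Longrightarrow> norm (u' t - g' t - B t (u t - g t)) \<le> \<epsilon> * norm (u t - g t)"
    and t: "t \<in> {a..b}"
  shows "norm (u t - g t) \<le> exp ((2 * (K + \<epsilon>) + 1) * (b - a)) * norm (u a - g a)"
    and "norm (u t - g t - M t (u a - g a)) \<le>
      \<epsilon> * (exp ((2 * (K + \<epsilon>) + 1) * (b - a)))\<^sup>2 * norm (u a - g a)"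
proof -
  define C where "C = exp ((2 * (K + \<epsilon>) + 1) * (b - a))"
  define w where "w s = u s - g s" for s
  have w': "(w has_vector_derivative u' s - g' s) (at s within {a..b})" if "s \<in> {a..b}" for s
    unfolding w_def by (intro derivative_intros u g that)
  have Bw: "norm (B s v) \<le> K * norm v" if "s \<in> {a..b}" for s v
    using norm_blinfun[of "B s" v] mult_right_mono[OF B[OF that] norm_ge_zero[of v]] by simp
  have w_bound: "norm (w s) \<le> C * norm (w a)" if s: "s \<in> {a..b}" for s
  proof -
    have "norm (w s) \<le> exp ((2 * (K + \<epsilon>) + 1) * (b - a)) * (norm (w a) + 0)"
    proof (rule gronwall_norm_bound[OF _ _ w' _ s])
      fix r assume r: "r \<in> {a..b}"
      show "norm (u' r - g' r) \<le> (K + \<epsilon>) * norm (w r) + 0"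
        using norm_triangle_ineq[of "u' r - g' r - B r (w r)" "B r (w r)"] lin[OF r] Bw[OF r, of "w r"]
        by (simp add: w_def algebra_simps)
    qed (use K \<epsilon> in auto)
    then show ?thesis by (simp add: C_def)
  qed
  then show "norm (u t - g t) \<le> exp ((2 * (K + \<epsilon>) + 1) * (b - a)) * norm (u a - g a)"
    using t by (simp add: C_def w_def)
  define e where "e s = w s - M s (w a)" for s
  have "norm (e t) \<le> exp ((2 * K + 1) * (b - a)) * (norm (e a) + \<epsilon> * (C * norm (w a)))"
  proof (rule gronwall_norm_bound[OF K _ _ _ t])
    show "0 \<le> \<epsilon> * (C * norm (w a))" using \<epsilon> by (simp add: C_def)
    fix s assume s: "s \<in> {a..b}"
    have "((\<lambda>s. M s (w a)) has_vector_derivative (B s o\<^sub>L M s) (w a)) (at s within {a..b})"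
      using bounded_linear.has_vector_derivative[OF blinfun.bounded_linear_left M[OF s]] .
    then show "(e has_vector_derivative (u' s - g' s) - (B s o\<^sub>L M s) (w a)) (at s within {a..b})"
      unfolding e_def by (intro has_vector_derivative_diff w' s)
    have "(u' s - g' s) - (B s o\<^sub>L M s) (w a) = (u' s - g' s - B s (w s)) + B s (e s)"
      by (simp add: e_def blinfun.diff_right)
    also have "norm \<dots> \<le> norm (u' s - g' s - B s (w s)) + norm (B s (e s))"
      by (rule norm_triangle_ineq)
    also have "\<dots> \<le> \<epsilon> * norm (w s) + K * norm (e s)"
      using lin[OF s] Bw[OF s] by (intro add_mono) (auto simp: w_def)
    also have "\<dots> \<le> K * norm (e s) + \<epsilon> * (C * norm (w a))"
      using mult_left_mono[OF w_bound[OF s] \<epsilon>] by simp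
    finally show "norm ((u' s - g' s) - (B s o\<^sub>L M s) (w a)) \<le> \<dots>" .
  qed
  also have "e a = 0" by (simp add: e_def M0)
  also have "exp ((2 * K + 1) * (b - a)) * (norm (0::'a) + \<epsilon> * (C * norm (w a)))
      \<le> C * (norm (0::'a) + \<epsilon> * (C * norm (w a)))"
    using ab \<epsilon> unfolding C_def by (intro mult_right_mono) (auto intro!: mult_right_mono)
  also have "\<dots> = \<epsilon> * C\<^sup>2 * norm (w a)" by (simp add: power2_eq_square)
  finally show "norm (u t - g t - M t (u a - g a)) \<le>
      \<epsilon> * (exp ((2 * (K + \<epsilon>) + 1) * (b - a)))\<^sup>2 * norm (u a - g a)"
    by (simp add: e_def w_def C_def)
qed

text \<open>The mean value theorem on the segment from \<open>x\<close> to \<open>u\<close>: the derivative is zero at \<open>x\<close> and, by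
  uniform continuity on the compact set, at most \<open>e\<close> on a short segment. Compactness makes
  \<open>\<delta>\<close> independent of \<open>x\<close>, which later gives a tube of constant width along the path.\<close>
lemma uniform_second_order_vanishing:
  fixes \<phi> :: "real ^ 'd \<Rightarrow> real ^ 'd \<Rightarrow> real"
  assumes S: "compact S" "convex S"
    and deriv: "\<And>x u. x \<in> S \<Longrightarrow> u \<in> S \<Longrightarrow> (\<phi> x has_derivative \<phi>' x u) (at u)"
    and cont: "\<And>i. continuous_on (S \<times> S) (\<lambda>(x, u). \<phi>' x u (axis i 1))"
    and zero: "\<And>x. x \<in> S \<Longrightarrow> \<phi> x x = 0"
    and zero': "\<And>x i. x \<in> S \<Longrightarrow> \<phi>' x x (axis i 1) = 0"
    and e: "e > 0"
  obtains \<delta> where "\<delta> > 0"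
    and "\<And>x u. x \<in> S \<Longrightarrow> u \<in> S \<Longrightarrow> dist x u \<le> \<delta> \<Longrightarrow> \<bar>\<phi> x u\<bar> \<le> e * norm (u - x)"
proof -
  \<comment> \<open>the operator norm is at most the sum of the absolute values on the basis vectors\<close>
  define \<eta> where "\<eta> = e / real CARD('d)"
  have \<eta>: "\<eta> > 0" using e by (simp add: \<eta>_def)
  have "\<exists>\<delta>>0. \<forall>p\<in>S\<times>S. \<forall>q\<in>S\<times>S. dist q p < \<delta> \<longrightarrow>
      dist (\<phi>' (fst q) (snd q) (axis i 1)) (\<phi>' (fst p) (snd p) (axis i 1)) < \<eta>" for i
    using compact_uniformly_continuous[OF cont[of i] compact_Times[OF S(1) S(1)]] \<eta>
    unfolding uniformly_continuous_on_def by (simp add: case_prod_unfold)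
  then obtain d where d: "\<And>i. d i > 0"
    and d': "\<And>i p q. p \<in> S\<times>S \<Longrightarrow> q \<in> S\<times>S \<Longrightarrow> dist q p < d i \<Longrightarrow>
      dist (\<phi>' (fst q) (snd q) (axis i 1)) (\<phi>' (fst p) (snd p) (axis i 1)) < \<eta>"
    by metis
  define \<delta> where "\<delta> = Min (range d) / 2"
  have Min: "Min (range d) > 0" using d by (subst Min_gr_iff) auto
  show thesis
  proof
    show "\<delta> > 0" using Min by (simp add: \<delta>_def)
    fix x u assume xu: "x \<in> S" "u \<in> S" "dist x u \<le> \<delta>"
    have seg: "closed_segment x u \<subseteq> S" using S(2) xu by (simp add: closed_segment_subset)
    have "norm (\<phi> x u - \<phi> x x) \<le> e * norm (u - x)"
    proof (rule differentiable_bound)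
      show "convex (closed_segment x u)" by simp
      fix s assume s: "s \<in> closed_segment x u"
      show "(\<phi> x has_derivative \<phi>' x s) (at s within closed_segment x u)"
        using deriv[of x s] seg s xu has_derivative_at_withinI by blast
      have lin: "bounded_linear (\<phi>' x s)" using deriv[of x s] seg s xu has_derivative_bounded_linear by blast
      have small: "\<bar>\<phi>' x s (axis i 1)\<bar> \<le> \<eta>" for i
      proof -
        have "dist (x, s) (x, x) = dist s x" by (simp add: dist_Pair_Pair)
        also have "\<dots> \<le> dist u x" using dist_in_closed_segment[OF s] by (simp add: dist_commute)
        also have "\<dots> < d i"
        proof -
          have "Min (range d) \<le> d i" by simp
          then show ?thesis using xu(3) Min unfolding \<delta>_def dist_commute[of u x] by linarith
        qed
        finally show ?thesis
          using d'[of "(x, x)" "(x, s)" i] xu(1) s seg zero'[of x i] by (auto simp: dist_real_def)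
      qed
      show "onorm (\<phi>' x s) \<le> e"
      proof (rule onorm_le)
        fix v
        have "\<phi>' x s v = \<phi>' x s (\<Sum>i\<in>UNIV. v $ i *\<^sub>R axis i 1)"
          using basis_expansion[of v] by (simp add: scalar_mult_eq_scaleR)
        also have "\<dots> = (\<Sum>i\<in>UNIV. v $ i * \<phi>' x s (axis i 1))"
          using lin by (simp add: linear_sum linear_cmul bounded_linear.linear)
        also have "norm \<dots> \<le> (\<Sum>i\<in>(UNIV::'d set). norm v * \<eta>)"
          unfolding real_norm_def
          by (rule order_trans[OF sum_abs], rule sum_mono)
             (auto simp: abs_mult intro!: mult_mono small component_le_norm_cart)
        also have "\<dots> = e * norm v" by (simp add: \<eta>_def)
        finally show "norm (\<phi>' x s v) \<le> e * norm v" .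
      qed
    qed auto
    then show "\<bar>\<phi> x u\<bar> \<le> e * norm (u - x)" using zero[OF xu(1)] by simp
  qed
qed

section \<open>Continuation and derivatives by comparison\<close>

text \<open>Continuous induction: \<open>limit\<close> gives \<open>P\<close> at the infimum of the points where it fails, and then
  \<open>extend\<close> keeps these points away from their infimum.\<close>
lemma interval_continuation:
  fixes P :: "real \<Rightarrow> bool"
  assumes start: "P a"
    and limit: "\<And>t. a < t \<Longrightarrow> t \<le> b \<Longrightarrow> (\<And>s. s \<in> {a..<t} \<Longrightarrow> P s) \<Longrightarrow> P t"
    and extend: "\<And>t. t \<in> {a..b} \<Longrightarrow> (\<And>s. s \<in> {a..t} \<Longrightarrow> P s) \<Longrightarrow> \<exists>e>0. \<forall>s\<in>{a..b}. \<bar>s - t\<bar> < e \<longrightarrow> P s"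
    and t: "t \<in> {a..b}"
  shows "P t"
proof (rule ccontr)
  assume "\<not> P t"
  define S where "S = {s \<in> {a..b}. \<not> P s}"
  have S: "t \<in> S" "bdd_below S" using t \<open>\<not> P t\<close> by (auto simp: S_def)
  define m where "m = Inf S"
  have m: "m \<in> {a..b}"
  proof -
    have "a \<le> m" unfolding m_def by (rule cInf_greatest) (use S in \<open>auto simp: S_def\<close>)
    moreover have "m \<le> t" unfolding m_def using S by (intro cInf_lower)
    ultimately show ?thesis using t by simp
  qed
  have before: "P s" if "s \<in> {a..<m}" for s
  proof (rule ccontr)
    assume "\<not> P s"
    then have "s \<in> S" using that m by (simp add: S_def)
    then have "m \<le> s" unfolding m_def using S(2) by (rule cInf_lower)
    then show False using that by simp
  qed
  have "P m"
    using limit[of m] m before start by (cases "m = a") auto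
  with before have "\<And>s. s \<in> {a..m} \<Longrightarrow> P s" by (metis atLeastAtMost_iff atLeastLessThan_iff order_le_less)
  with extend[OF m] obtain e where e: "e > 0" "\<forall>s\<in>{a..b}. \<bar>s - m\<bar> < e \<longrightarrow> P s" by blast
  have "m + e \<le> s" if "s \<in> S" for s
  proof -
    have "m \<le> s" using cInf_lower[OF that S(2)] by (simp add: m_def)
    moreover have "\<not> \<bar>s - m\<bar> < e" using that e by (auto simp: S_def)
    ultimately show ?thesis by linarith
  qed
  then have "m + e \<le> m" unfolding m_def using S(1) by (intro cInf_greatest) auto
  then show False using e(1) by simp
qed

text \<open>The chain rule for a map \<open>G\<close> that is a differentiable function of \<open>F\<close> to first order only. It
  is applied to the positions of the trajectories at two times; no map carrying the earlier
  position to the later one is at hand, as the flow is given by trajectories starting at time 0.\<close>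
lemma has_derivative_asymptotic:
  fixes F :: "'a::real_normed_vector \<Rightarrow> 'b::real_normed_vector" and G :: "'a \<Rightarrow> 'c::real_normed_vector"
  assumes F: "(F has_derivative D) (at x)" and M: "bounded_linear M"
    and close: "\<And>e. e > 0 \<Longrightarrow> \<forall>\<^sub>F z in at x. norm (G z - G x - M (F z - F x)) \<le> e * norm (F z - F x)"
  shows "(G has_derivative (\<lambda>h. M (D h))) (at x)"
proof -
  define N where "N z = G z - M (F z)" for z
  have lin: "linear M" using M by (rule bounded_linear.linear)
  have bl: "bounded_linear D" using F by (rule has_derivative_bounded_linear)
  obtain K where K: "K > 0" "\<And>h. norm (D h) \<le> norm h * K"
    using bounded_linear.pos_bounded[OF bl] by blast
  have "(N has_derivative (\<lambda>h. 0)) (at x)"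
    unfolding has_derivative_within_alt2
  proof (intro conjI allI impI)
    show "bounded_linear (\<lambda>h::'a. 0::'c)" by simp
    fix e :: real assume e: "e > 0"
    define \<eta> where "\<eta> = e / (K + 1)"
    have \<eta>: "\<eta> > 0" using e K by (simp add: \<eta>_def)
    have "\<forall>\<^sub>F z in at x. norm (F z - F x - D (z - x)) \<le> 1 * norm (z - x)"
      using F unfolding has_derivative_within_alt2 by (meson zero_less_one)
    with close[OF \<eta>] show "\<forall>\<^sub>F z in at x. norm (N z - N x - 0) \<le> e * norm (z - x)"
    proof eventually_elim
      case (elim z)
      have "norm (F z - F x) \<le> norm (F z - F x - D (z - x)) + norm (D (z - x))"
        by (metis diff_add_cancel norm_triangle_ineq)
      also have "\<dots> \<le> (K + 1) * norm (z - x)"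
        using elim(2) K(2)[of "z - x"] by (simp add: algebra_simps)
      finally have "\<eta> * norm (F z - F x) \<le> \<eta> * ((K + 1) * norm (z - x))"
        using \<eta> by (intro mult_left_mono) auto
      also have "\<dots> = e * norm (z - x)" using K by (simp add: \<eta>_def)
      finally show ?case using elim(1) by (simp add: N_def linear_diff[OF lin] algebra_simps)
    qed
  qed
  moreover have "((\<lambda>z. M (F z)) has_derivative (\<lambda>h. M (D h))) (at x)"
    using bounded_linear.has_derivative[OF M F] .
  ultimately have "((\<lambda>z. N z + M (F z)) has_derivative (\<lambda>h. 0 + M (D h))) (at x)"
    by (rule has_derivative_add)
  then show ?thesis by (simp add: N_def)
qed

section \<open>Smooth functions and charts\<close>

lemma smooth_on_imp_continuous_on: "smooth_on S f \<Longrightarrow> continuous_on S f"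
  unfolding smooth_on_def by (metis Ck_on.simps(1))

lemma smooth_on_has_derivative:
  assumes "smooth_on S f" "x \<in> S"
  shows "(f has_derivative frechet_derivative f (at x)) (at x)"
proof -
  have "Ck_on (Suc 0) S f" using assms unfolding smooth_on_def by blast
  then show ?thesis using assms(2) by (simp add: frechet_derivative_works)
qed

lemma smooth_on_frechet_derivative:
  assumes "smooth_on S f" shows "smooth_on S (\<lambda>x. frechet_derivative f (at x) v)"
  unfolding smooth_on_def
proof
  fix k have "Ck_on (Suc k) S f" using assms unfolding smooth_on_def by blast
  then show "Ck_on k S (\<lambda>x. frechet_derivative f (at x) v)" by simp
qed

lemmas continuous_on_frechet_derivative =
  smooth_on_imp_continuous_on[OF smooth_on_frechet_derivative]

lemma chart_inv_in_dom: "u \<in> chart_img c \<Longrightarrow> chart_inv c u \<in> chart_dom c"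
  by (simp add: chart_img_def chart_inv_def inv_into_into)

lemma coords_in_img: "p \<in> chart_dom c \<Longrightarrow> coords c p \<in> chart_img c"
  by (simp add: chart_img_def)

lemma coords_chart_inv: "u \<in> chart_img c \<Longrightarrow> coords c (chart_inv c u) = u"
  by (simp add: chart_img_def chart_inv_def f_inv_into_f)

lemma chart_inv_coords: "is_chart c \<Longrightarrow> p \<in> chart_dom c \<Longrightarrow> chart_inv c (coords c p) = p"
  unfolding is_chart_def homeomorphism_def by blast

lemma isCont_coords: "is_chart c \<Longrightarrow> p \<in> chart_dom c \<Longrightarrow> isCont (coords c) p"
  unfolding is_chart_def homeomorphism_def using continuous_on_eq_continuous_at by blast

lemma isCont_chart_inv: "is_chart c \<Longrightarrow> u \<in> chart_img c \<Longrightarrow> isCont (chart_inv c) u"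
  unfolding is_chart_def homeomorphism_def using continuous_on_eq_continuous_at by blast

lemma open_chart_dom: "is_chart c \<Longrightarrow> open (chart_dom c)"
  and open_chart_img: "is_chart c \<Longrightarrow> open (chart_img c)"
  unfolding is_chart_def by auto

lemma continuous_on_chart_inv: "is_chart c \<Longrightarrow> continuous_on (chart_img c) (chart_inv c)"
  unfolding is_chart_def homeomorphism_def by auto

lemma continuous_on_coords: "is_chart c \<Longrightarrow> continuous_on (chart_dom c) (coords c)"
  unfolding is_chart_def homeomorphism_def by auto

lemma tendsto_coords:
  fixes p :: "'m::t2_space" and c :: "('m, 'd::finite) chart"
  assumes "is_chart c" "(f \<longlongrightarrow> p) F" "p \<in> chart_dom c"
  shows "((\<lambda>x. coords c (f x)) \<longlongrightarrow> coords c p) F"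
  using isCont_tendsto_compose[OF isCont_coords[OF assms(1,3)] assms(2)] .

text \<open>A bound \<open>q\<close> smaller than the radius \<open>r\<close>, proved under the assumption that the curve has not left
  the tube of radius \<open>r\<close>, prevents it from leaving. That the curve cannot escape from the
  chart domain itself follows from the compactness of the image of \<open>S\<close>, which is therefore
  closed in the Hausdorff space.\<close>
lemma stays_in_tube:
  fixes c :: "('m::t2_space, 'd::finite) chart" and \<gamma> :: "real \<Rightarrow> 'm"
  assumes c: "is_chart c"
    and \<gamma>: "continuous_on {a..b} \<gamma>" and g: "continuous_on {a..b} g"
    and S: "compact S" "S \<subseteq> chart_img c"
    and tube: "\<And>t w. t \<in> {a..b} \<Longrightarrow> norm (w - g t) \<le> r \<Longrightarrow> w \<in> S"
    and start: "\<gamma> a \<in> chart_dom c" "norm (coords c (\<gamma> a) - g a) \<le> r"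
    and q: "q < r"
    and apriori: "\<And>t. t \<in> {a..b} \<Longrightarrow>
      (\<And>s. s \<in> {a..t} \<Longrightarrow> \<gamma> s \<in> chart_dom c \<and> norm (coords c (\<gamma> s) - g s) \<le> r) \<Longrightarrow>
      norm (coords c (\<gamma> t) - g t) \<le> q"
    and t: "t \<in> {a..b}"
  shows "\<gamma> t \<in> chart_dom c \<and> norm (coords c (\<gamma> t) - g t) \<le> r"
proof (rule interval_continuation[OF _ _ _ t,
    where P = "\<lambda>t. \<gamma> t \<in> chart_dom c \<and> norm (coords c (\<gamma> t) - g t) \<le> r"])
  show "\<gamma> a \<in> chart_dom c \<and> norm (coords c (\<gamma> a) - g a) \<le> r" using start by blast
next
  fix t assume t: "a < t" "t \<le> b"
    and before: "\<And>s. s \<in> {a..<t} \<Longrightarrow> \<gamma> s \<in> chart_dom c \<and> norm (coords c (\<gamma> s) - g s) \<le> r"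
  have cl: "closure {a..<t} = {a..t}" using t by simp
  have sub: "{a..t} \<subseteq> {a..b}" using t by auto
  have "\<gamma> ` {a..<t} \<subseteq> chart_inv c ` S"
  proof
    fix p assume "p \<in> \<gamma> ` {a..<t}"
    then obtain s where s: "s \<in> {a..<t}" "p = \<gamma> s" by blast
    have "coords c (\<gamma> s) \<in> S" using tube[of s "coords c (\<gamma> s)"] before[OF s(1)] s(1) t by auto
    then show "p \<in> chart_inv c ` S"
      using chart_inv_coords[OF c, of p] before[OF s(1)] s(2) by (metis imageI)
  qed
  moreover have "closed (chart_inv c ` S)"
    by (intro compact_imp_closed compact_continuous_image S
        continuous_on_subset[OF continuous_on_chart_inv[OF c] S(2)])
  ultimately have "\<gamma> ` {a..t} \<subseteq> chart_inv c ` S"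
    using image_closure_subset[of "{a..<t}" \<gamma> "chart_inv c ` S"] continuous_on_subset[OF \<gamma> sub]
    by (simp add: cl)
  then have dom: "\<gamma> s \<in> chart_dom c" if "s \<in> {a..t}" for s
    using that S(2) chart_inv_in_dom[of _ c] by (metis image_iff image_subset_iff subset_iff)
  have "continuous_on (closure {a..<t}) (\<lambda>s. norm (coords c (\<gamma> s) - g s))"
    unfolding cl
  proof (intro continuous_intros)
    show "continuous_on {a..t} (\<lambda>s. coords c (\<gamma> s))"
      by (rule continuous_on_compose2[OF continuous_on_coords[OF c] continuous_on_subset[OF \<gamma> sub]])
        (use dom in auto)
    show "continuous_on {a..t} g" using g sub by (rule continuous_on_subset)
  qed
  then have "norm (coords c (\<gamma> t) - g t) \<le> r"
    by (rule continuous_le_on_closure) (use before t cl in auto)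
  then show "\<gamma> t \<in> chart_dom c \<and> norm (coords c (\<gamma> t) - g t) \<le> r" using dom[of t] t by simp
next
  fix t assume t: "t \<in> {a..b}"
    and before: "\<And>s. s \<in> {a..t} \<Longrightarrow> \<gamma> s \<in> chart_dom c \<and> norm (coords c (\<gamma> s) - g s) \<le> r"
  have now: "\<gamma> t \<in> chart_dom c" "norm (coords c (\<gamma> t) - g t) < r"
    using before[of t] t apriori[OF t before] q by auto
  have lim: "(\<gamma> \<longlongrightarrow> \<gamma> t) (at t within {a..b})" using \<gamma> t unfolding continuous_on_def by blast
  have "\<forall>\<^sub>F s in at t within {a..b}. \<gamma> s \<in> chart_dom c"
    using topological_tendstoD[OF lim open_chart_dom[OF c] now(1)] .
  moreover have "((\<lambda>s. norm (coords c (\<gamma> s) - g s)) \<longlongrightarrow> norm (coords c (\<gamma> t) - g t)) (at t within {a..b})"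
    using tendsto_coords[OF c lim now(1)] g t unfolding continuous_on_def by (intro tendsto_intros) auto
  then have "\<forall>\<^sub>F s in at t within {a..b}. norm (coords c (\<gamma> s) - g s) < r"
    using now(2) by (rule order_tendstoD)
  ultimately have "\<forall>\<^sub>F s in at t within {a..b}. \<gamma> s \<in> chart_dom c \<and> norm (coords c (\<gamma> s) - g s) \<le> r"
    by eventually_elim auto
  then obtain e where "e > 0" and e: "\<And>s. s \<in> {a..b} \<Longrightarrow> s \<noteq> t \<Longrightarrow> dist s t < e \<Longrightarrow>
      \<gamma> s \<in> chart_dom c \<and> norm (coords c (\<gamma> s) - g s) \<le> r"
    unfolding eventually_at by blast
  then show "\<exists>e>0. \<forall>s\<in>{a..b}. \<bar>s - t\<bar> < e \<longrightarrow> \<gamma> s \<in> chart_dom c \<and> norm (coords c (\<gamma> s) - g s) \<le> r"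
    using now e by (intro exI[of _ e]) (metis dist_real_def less_imp_le)
qed

section \<open>The Hamiltonian field near the diagonal\<close>

definition christoffel_map ::
  "('m, 'd::finite) christoffel \<Rightarrow> ('m, 'd) chart \<Rightarrow> 'm \<Rightarrow> real ^ 'd \<Rightarrow> real ^ 'd \<Rightarrow> real ^ 'd"
  where "christoffel_map \<Gamma> c p \<xi> w = (\<chi> m. \<Sum>i\<in>UNIV. \<Sum>j\<in>UNIV. \<Gamma> c p m i j * \<xi> $ i * w $ j)"

lemma coord_deriv_eq:
  assumes "u \<in> chart_img c" "((\<lambda>u. f (chart_inv c u)) has_derivative f') (at u)"
  shows "coord_deriv c j f (chart_inv c u) = f' (axis j 1)"
  using frechet_derivative_at[OF assms(2)] assms(1)
  by (simp add: coord_deriv_def coords_chart_inv o_def)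

text \<open>Partial derivatives in \<open>z\<close> are restrictions of the total derivative of the coordinate expression
  on the product of two chart images, whose smoothness yields continuity in both variables.\<close>
lemma ether_second_derivative:
  fixes H :: "('m::{t2_space,second_countable_topology}, 'd::finite) fun_form"
  assumes c: "is_chart c" "c \<in> A" and H: "smooth_fun_form A H"
  obtains D where
    "\<And>x u. x \<in> chart_img c \<Longrightarrow> u \<in> chart_img c \<Longrightarrow>
      ((\<lambda>u. coord_deriv c j (\<lambda>w. H c (chart_inv c x) w $ k) (chart_inv c u)) has_derivative D x u) (at u)"
    and "\<And>v. continuous_on (chart_img c \<times> chart_img c) (\<lambda>(x, u). D x u v)"
proof -
  define h where "h = (\<lambda>(u, v). H c (chart_inv c u) (chart_inv c v))"
  define h1 where "h1 p = frechet_derivative h (at p) (0, axis j 1)" for p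
  define D where "D x u v = frechet_derivative h1 (at (x, u)) (0, v) $ k" for x u v
  have h: "smooth_on (chart_img c \<times> chart_img c) h"
    using H c(2) unfolding smooth_fun_form_def h_def by blast
  have h1: "smooth_on (chart_img c \<times> chart_img c) h1"
    unfolding h1_def by (rule smooth_on_frechet_derivative[OF h])
  have eq: "coord_deriv c j (\<lambda>w. H c (chart_inv c x) w $ k) (chart_inv c u) = h1 (x, u) $ k"
    if "x \<in> chart_img c" "u \<in> chart_img c" for x u
  proof -
    have "(h has_derivative frechet_derivative h (at (x, u))) (at (x, u))"
      using smooth_on_has_derivative[OF h] that by blast
    moreover have "((\<lambda>u. (x, u)) has_derivative (\<lambda>v. (0, v))) (at u)"
      by (auto intro!: derivative_eq_intros)
    ultimately have "((\<lambda>u. h (x, u)) has_derivative (\<lambda>v. frechet_derivative h (at (x, u)) (0, v))) (at u)"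
      using has_derivative_compose by fastforce
    then have "((\<lambda>u. h (x, u) $ k) has_derivative (\<lambda>v. frechet_derivative h (at (x, u)) (0, v) $ k)) (at u)"
      by (rule bounded_linear.has_derivative[OF bounded_linear_vec_nth])
    then show ?thesis
      unfolding h1_def by (intro coord_deriv_eq that) (simp add: h_def)
  qed
  show thesis
  proof
    fix x u assume xu: "x \<in> chart_img c" "u \<in> chart_img c"
    have "(h1 has_derivative frechet_derivative h1 (at (x, u))) (at (x, u))"
      using smooth_on_has_derivative[OF h1] xu by blast
    moreover have "((\<lambda>u. (x, u)) has_derivative (\<lambda>v. (0, v))) (at u)"
      by (auto intro!: derivative_eq_intros)
    ultimately have "((\<lambda>u. h1 (x, u)) has_derivative (\<lambda>v. frechet_derivative h1 (at (x, u)) (0, v))) (at u)"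
      using has_derivative_compose by fastforce
    then have "((\<lambda>u. h1 (x, u) $ k) has_derivative D x u) (at u)"
      unfolding D_def by (rule bounded_linear.has_derivative[OF bounded_linear_vec_nth])
    then show "((\<lambda>u. coord_deriv c j (\<lambda>w. H c (chart_inv c x) w $ k) (chart_inv c u)) has_derivative D x u) (at u)"
      by (rule has_derivative_transform_within_open[OF _ open_chart_img[OF c(1)] xu(2)])
        (simp add: eq xu(1))
  next
    fix v
    have "continuous_on (chart_img c \<times> chart_img c) (\<lambda>p. frechet_derivative h1 (at p) (0, v) $ k)"
        by (rule bounded_linear.continuous_on[OF bounded_linear_vec_nth continuous_on_frechet_derivative[OF h1]])
    then show "continuous_on (chart_img c \<times> chart_img c) (\<lambda>(x, u). D x u v)"
      by (simp add: D_def case_prod_unfold)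
  qed
qed

text \<open>The minimum of \<open>norm (w v* P u)\<close> over \<open>u \<in> S\<close> and unit vectors \<open>w\<close> is attained, hence positive.\<close>
lemma invertible_family_lower_bound:
  fixes P :: "'a::topological_space \<Rightarrow> real ^ 'd::finite ^ 'd"
  assumes S: "compact S" and P: "\<And>j k. continuous_on S (\<lambda>u. P u $ j $ k)"
    and inv: "\<And>u. u \<in> S \<Longrightarrow> invertible (P u)"
  obtains C where "C > 0" and "\<And>u w. u \<in> S \<Longrightarrow> norm w \<le> C * norm (w v* P u)"
proof (cases "S = {}")
  case True
  show thesis
  proof (rule that)
    show "(0::real) < 1" by simp
    show "norm w \<le> 1 * norm (w v* P u)" if "u \<in> S" for u w using that True by blast
  qed
next
  case False
  define F where "F = (\<lambda>(u, w). norm (w v* P u))"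
  have cont: "continuous_on (S \<times> sphere 0 1) F"
  proof -
    have "continuous_on (S \<times> sphere 0 1) (\<lambda>p. P (fst p) $ j $ k)" for j k
      by (rule continuous_on_compose2[OF P continuous_on_fst[OF continuous_on_id]]) auto
    then have "continuous_on (S \<times> sphere 0 1) (\<lambda>p. \<chi> j k. P (fst p) $ j $ k)"
      by (intro continuous_on_vec_lambda)
    then have "continuous_on (S \<times> sphere 0 1) (\<lambda>p. P (fst p))" by (simp add: vec_lambda_eta)
    then show ?thesis
      unfolding F_def case_prod_unfold vector_matrix_mult_def by (intro continuous_intros)
  qed
  have "sphere (0::real^'d) 1 \<noteq> {}" by simp
  then have ne: "S \<times> sphere (0::real^'d) 1 \<noteq> {}" using False by blast
  have "compact (S \<times> sphere (0::real^'d) 1)" by (intro compact_Times S compact_sphere)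
  then obtain p where p: "p \<in> S \<times> sphere 0 1" "\<And>q. q \<in> S \<times> sphere 0 1 \<Longrightarrow> F p \<le> F q"
    using continuous_attains_inf[OF _ ne cont] by blast
  have nz: "w v* P u \<noteq> 0" if "u \<in> S" "w \<noteq> 0" for u w
  proof
    assume "w v* P u = 0"
    moreover obtain Q where "P u ** Q = mat 1"
      using inv[OF \<open>u \<in> S\<close>] unfolding invertible_def by blast
    ultimately have "w = 0 v* Q"
      by (metis vector_matrix_mul_assoc vector_matrix_mul_rid)
    then show False using that(2) by simp
  qed
  have "snd p \<noteq> 0" using p(1) by auto
  then have "F p > 0" using nz[of "fst p" "snd p"] p(1) by (auto simp: F_def)
  show thesis
  proof
    show "1 / F p > 0" using \<open>F p > 0\<close> by simp
    fix u w assume u: "u \<in> S"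
    show "norm w \<le> 1 / F p * norm (w v* P u)"
    proof (cases "w = 0")
      case False
      then have "F p \<le> norm (((1 / norm w) *\<^sub>R w) v* P u)"
        using p(2)[of "(u, (1 / norm w) *\<^sub>R w)"] u by (simp add: F_def)
      also have "\<dots> = norm (w v* P u) / norm w"
        by (simp add: scaleR_vector_matrix_assoc)
      finally show ?thesis using False \<open>F p > 0\<close> by (simp add: field_simps)
    qed simp
  qed
qed

text \<open>The field \<open>f\<close> satisfies \<open>f \<omega> = p\<close>, where \<open>p\<close> is the differential of the Hamiltonian. Multiplying
  the error \<open>E = f - \<xi> + \<Gamma> (\<xi>, u - x)\<close> by \<open>\<omega>\<close> at \<open>u\<close> thus removes the Poisson tensor, and \<open>E\<close> is
  recovered with a uniform constant by the preceding lemma; so the Poisson tensor need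
  not be differentiated. The components of \<open>E \<omega>\<close> are \<open>\<xi>\<^sup>k R\<^sub>k\<^sub>j (x, u)\<close>, where \<open>R\<close> is the
  remainder defined in the proof. It vanishes at \<open>u = x\<close> because the gradient of \<open>H\<close> is \<open>2 \<omega>\<close>
  there, and so does its derivative in \<open>u\<close>, because \<open>\<nabla>\<nabla>H = 0\<close> turns the second derivative
  of \<open>H\<^sub>k\<close> into \<open>2 \<Gamma>\<^sup>l\<^sub>i\<^sub>j \<omega>\<^sub>k\<^sub>l\<close>, \<open>\<nabla>\<omega> = 0\<close> turns the derivative of \<open>\<omega>\<^sub>k\<^sub>j\<close> into
  \<open>\<Gamma>\<^sup>l\<^sub>i\<^sub>k \<omega>\<^sub>l\<^sub>j + \<Gamma>\<^sup>l\<^sub>i\<^sub>j \<omega>\<^sub>k\<^sub>l\<close>, and the two terms that are left cancel by the symmetry of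
  \<open>\<Gamma>\<close>. The remainder is thus of second order.\<close>
lemma ether_field_linearisation:
  fixes A :: "('m::{t2_space,second_countable_topology}, 'd::finite) chart set"
  assumes c: "is_chart c" "c \<in> A"
    and \<omega>: "symplectic_form A \<omega>" and \<Gamma>: "affine_connection A \<Gamma>" "torsion_free A \<Gamma>" "parallel_form A \<Gamma> \<omega>"
    and H: "smooth_fun_form A H" "diagonal_conditions A \<omega> \<Gamma> H"
    and S: "compact S" "convex S" "S \<subseteq> chart_img c" and e: "e > 0"
  obtains \<delta> where "\<delta> > 0"
    and "\<And>x u \<xi>. x \<in> S \<Longrightarrow> u \<in> S \<Longrightarrow> dist x u \<le> \<delta> \<Longrightarrow>
      norm (ether_field \<omega> H c (chart_inv c x) ((1/2) *\<^sub>R \<xi>) c (chart_inv c u) - \<xi>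
        + christoffel_map \<Gamma> c (chart_inv c x) \<xi> (u - x)) \<le> e * norm \<xi> * norm (u - x)"
proof -
  define w where "w u = \<omega> c (chart_inv c u)" for u
  define G where "G x = \<Gamma> c (chart_inv c x)" for x
  define h where "h k j x u = coord_deriv c j (\<lambda>w. H c (chart_inv c x) w $ k) (chart_inv c u)" for k j x u
  define w' where "w' j k u = frechet_derivative (\<lambda>u. w u $ j $ k) (at u)" for j k u
  have w_smooth: "smooth_on (chart_img c) (\<lambda>u. w u $ j $ k)" for j k
    using \<omega> c(2) unfolding symplectic_form_def smooth_in_def w_def o_def by blast
  have w_deriv: "((\<lambda>u. w u $ j $ k) has_derivative w' j k u) (at u)" if "u \<in> chart_img c" for j k u
    unfolding w'_def by (rule smooth_on_has_derivative[OF w_smooth that])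
  have w_lin: "linear (w' j k u)" if "u \<in> chart_img c" for j k u
    using has_derivative_linear[OF w_deriv[OF that]] .
  have G_cont: "continuous_on (chart_img c) (\<lambda>x. G x m i j)" for m i j
    using \<Gamma>(1) c(2) unfolding affine_connection_def smooth_in_def o_def G_def
    by (intro smooth_on_imp_continuous_on) blast
  have "\<exists>D. (\<forall>x u. x \<in> chart_img c \<longrightarrow> u \<in> chart_img c \<longrightarrow> (h k j x has_derivative D x u) (at u)) \<and>
      (\<forall>v. continuous_on (chart_img c \<times> chart_img c) (\<lambda>(x, u). D x u v))" for k j
    unfolding h_def by (rule ether_second_derivative[OF c H(1), of j k]) blast
  then obtain D where D: "\<And>k j x u. x \<in> chart_img c \<Longrightarrow> u \<in> chart_img c \<Longrightarrow> (h k j x has_derivative D k j x u) (at u)"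
    and D_cont: "\<And>k j v. continuous_on (chart_img c \<times> chart_img c) (\<lambda>(x, u). D k j x u v)"
    by metis
  have diag: "h k j x x = 2 * w x $ k $ j" if "x \<in> chart_img c" for k j x
    using H(2) c(2) chart_inv_in_dom[OF that] unfolding diagonal_conditions_def h_def w_def by blast
  have diag2: "D k j x x (axis i 1) = (\<Sum>l\<in>UNIV. G x l i j * (2 * w x $ k $ l))" if x: "x \<in> chart_img c" for k j i x
  proof -
    have "cov_deriv2 \<Gamma> c i j (\<lambda>z. H c (chart_inv c x) z $ k) (chart_inv c x) = 0"
      using H(2) c(2) chart_inv_in_dom[OF x] unfolding diagonal_conditions_def by blast
    moreover have "coord_deriv c i (\<lambda>q. coord_deriv c j (\<lambda>z. H c (chart_inv c x) z $ k) q) (chart_inv c x)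
        = D k j x x (axis i 1)"
      using D[OF x x, of k j] by (intro coord_deriv_eq x) (simp add: h_def[abs_def])
    ultimately show ?thesis
      using diag[OF x, of k] by (simp add: cov_deriv2_def G_def h_def)
  qed
  have parallel: "w' k j x (axis i 1) = (\<Sum>l\<in>UNIV. G x l i k * w x $ l $ j) + (\<Sum>l\<in>UNIV. G x l i j * w x $ k $ l)"
    if x: "x \<in> chart_img c" for k j i x
  proof -
    have "coord_deriv c i (\<lambda>q. \<omega> c q $ k $ j) (chart_inv c x) = w' k j x (axis i 1)"
      using w_deriv[OF x, of k j] by (intro coord_deriv_eq x) (simp add: w_def)
    moreover have "coord_deriv c i (\<lambda>q. \<omega> c q $ k $ j) (chart_inv c x)
          - (\<Sum>l\<in>UNIV. G x l i k * w x $ l $ j) - (\<Sum>l\<in>UNIV. G x l i j * w x $ k $ l) = 0"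
      using \<Gamma>(3) c(2) chart_inv_in_dom[OF x] unfolding parallel_form_def G_def w_def by blast
    ultimately show ?thesis by simp
  qed
  have sym: "G x l i k = G x l k i" if "x \<in> chart_img c" for x l i k
    using \<Gamma>(2) c(2) chart_inv_in_dom[OF that] unfolding torsion_free_def G_def by blast
  define R where "R k j x u = h k j x u / 2 - w u $ k $ j
      + (\<Sum>l\<in>UNIV. \<Sum>i\<in>UNIV. G x l k i * (u - x) $ i * w u $ l $ j)" for k j x u
  define R' where "R' k j x u v = D k j x u v / 2 - w' k j u v
      + (\<Sum>l\<in>UNIV. \<Sum>i\<in>UNIV. G x l k i * (v $ i * w u $ l $ j + (u - x) $ i * w' l j u v))" for k j x u v
  have w_cont: "continuous_on S (\<lambda>u. w u $ j $ k)" for j k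
    using smooth_on_imp_continuous_on[OF w_smooth] S(3) by (rule continuous_on_subset)
  have w_inv: "invertible (w u)" if "u \<in> chart_img c" for u
    using \<omega> c(2) chart_inv_in_dom[OF that] unfolding symplectic_form_def w_def by blast
  have "\<exists>C>0. \<forall>u\<in>S. \<forall>v. norm v \<le> C * norm (v v* w u)"
    by (rule invertible_family_lower_bound[OF S(1), of w]) (use w_cont w_inv S(3) in blast)+
  then obtain C where C: "C > 0" "\<And>u v. u \<in> S \<Longrightarrow> norm v \<le> C * norm (v v* w u)"
    by blast
  define \<eta> where "\<eta> = e / (C * real CARD('d) * real CARD('d))"
  have \<eta>: "\<eta> > 0" using e C by (simp add: \<eta>_def)
  have "\<exists>\<delta>>0. \<forall>x\<in>S. \<forall>u\<in>S. dist x u \<le> \<delta> \<longrightarrow> \<bar>R k j x u\<bar> \<le> \<eta> * norm (u - x)" for k j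
  proof (rule uniform_second_order_vanishing[OF S(1,2), of "R k j" "R' k j" \<eta>])
    fix x u assume "x \<in> S" "u \<in> S"
    then have xu: "x \<in> chart_img c" "u \<in> chart_img c" using S(3) by auto
    note [derivative_intros] = D[OF xu] w_deriv[OF xu(2)] bounded_linear.has_derivative[OF bounded_linear_vec_nth]
    show "(R k j x has_derivative R' k j x u) (at u)"
      unfolding R_def R'_def
      by (auto intro!: derivative_eq_intros ext simp: algebra_simps sum.distrib sum_divide_distrib[symmetric])
  next
    fix i
    have fstc: "continuous_on (S \<times> S) (\<lambda>p. f (fst p))" if "continuous_on (chart_img c) f" for f :: "_ \<Rightarrow> real"
      by (rule continuous_on_compose2[OF that continuous_on_fst[OF continuous_on_id]]) (use S(3) in auto)
    have sndc: "continuous_on (S \<times> S) (\<lambda>p. f (snd p))" if "continuous_on (chart_img c) f" for f :: "_ \<Rightarrow> real"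
      by (rule continuous_on_compose2[OF that continuous_on_snd[OF continuous_on_id]]) (use S(3) in auto)
    have D_c: "continuous_on (S \<times> S) (\<lambda>p. D k j (fst p) (snd p) (axis i 1))"
      using continuous_on_subset[OF D_cont, of "S \<times> S"] S(3) by (auto simp: case_prod_unfold)
    have w'_c: "continuous_on (S \<times> S) (\<lambda>p. w' k j (snd p) (axis i 1))" for k j
      using sndc[OF continuous_on_frechet_derivative[OF w_smooth]] by (simp add: w'_def)
    note G_c = fstc[OF G_cont] and w_c = sndc[OF smooth_on_imp_continuous_on[OF w_smooth]]
    show "continuous_on (S \<times> S) (\<lambda>(x, u). R' k j x u (axis i 1))"
      unfolding R'_def case_prod_unfold by (intro D_c w'_c G_c w_c continuous_intros) auto
  next
    fix x assume "x \<in> S"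
    then have x: "x \<in> chart_img c" using S(3) by auto
    show "R k j x x = 0" using diag[OF x] by (simp add: R_def)
    fix i
    have "(\<Sum>l\<in>UNIV. \<Sum>a\<in>UNIV. G x l k a * ((axis i 1 :: real^'d) $ a * w x $ l $ j + (x - x) $ a * w' l j x (axis i 1)))
        = (\<Sum>l\<in>UNIV. G x l k i * w x $ l $ j)"
      by (intro sum.cong refl) (simp add: axis_def if_distrib[of "\<lambda>z. z * _"] if_distrib[of "\<lambda>z. _ * z"] cong: if_cong)
    then show "R' k j x x (axis i 1) = 0"
      unfolding R'_def diag2[OF x] parallel[OF x]
      by (simp add: sym[OF x, of _ i k] sum_divide_distrib)
  qed (use \<eta> in blast)+
  then obtain d where d: "\<And>k j. d k j > 0"
      "\<And>k j x u. x \<in> S \<Longrightarrow> u \<in> S \<Longrightarrow> dist x u \<le> d k j \<Longrightarrow> \<bar>R k j x u\<bar> \<le> \<eta> * norm (u - x)"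
    by metis
  define \<delta> where "\<delta> = Min (range (\<lambda>(k, j). d k j))"
  have \<delta>_le: "\<delta> \<le> d k j" for k j
    unfolding \<delta>_def by (rule Min_le) (auto intro!: rev_image_eqI[of "(k, j)"])
  show thesis
  proof
    show "\<delta> > 0" unfolding \<delta>_def using d(1) by (subst Min_gr_iff) auto
    fix x u \<xi> assume xu: "x \<in> S" "u \<in> S" "dist x u \<le> \<delta>"
    then have x: "x \<in> chart_img c" and u: "u \<in> chart_img c" using S(3) by auto
    define f where "f = ether_field \<omega> H c (chart_inv c x) ((1/2) *\<^sub>R \<xi>) c (chart_inv c u)"
    define p :: "real^'d" where "p = (\<chi> j. \<Sum>k\<in>UNIV. \<xi> $ k * (h k j x u / 2))"
    define E where "E = f - \<xi> + christoffel_map \<Gamma> c (chart_inv c x) \<xi> (u - x)"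
    have "matrix_inv (w u) ** w u = mat 1"
      using w_inv[OF u] unfolding invertible_def matrix_inv_def by (metis (mono_tags, lifting) someI_ex)
    moreover have "f = p v* matrix_inv (w u)"
      unfolding f_def ether_field_def p_def vector_matrix_mult_def poisson_tensor_def vec_eq_iff
      by (auto simp: h_def w_def sum_distrib_left sum_distrib_right mult_ac intro!: trans[OF sum.swap] sum.cong)
    ultimately have fw: "f v* w u = p"
      by (simp add: vector_matrix_mul_assoc)
    have E_w: "(E v* w u) $ j = (\<Sum>k\<in>UNIV. \<xi> $ k * R k j x u)" for j
    proof -
      have "(E v* w u) $ j = p $ j - (\<Sum>k\<in>UNIV. \<xi> $ k * w u $ k $ j)
          + (\<Sum>m\<in>UNIV. christoffel_map \<Gamma> c (chart_inv c x) \<xi> (u - x) $ m * w u $ m $ j)"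
        unfolding E_def fw[symmetric]
        by (simp add: vector_matrix_mult_def sum.distrib sum_subtractf algebra_simps)
      also have "(\<Sum>m\<in>UNIV. christoffel_map \<Gamma> c (chart_inv c x) \<xi> (u - x) $ m * w u $ m $ j)
          = (\<Sum>m\<in>UNIV. \<Sum>k\<in>UNIV. \<Sum>i\<in>UNIV. \<xi> $ k * (G x m k i * (u - x) $ i * w u $ m $ j))"
        by (simp add: christoffel_map_def G_def sum_distrib_left mult_ac)
      also have "\<dots> = (\<Sum>k\<in>UNIV. \<Sum>m\<in>UNIV. \<Sum>i\<in>UNIV. \<xi> $ k * (G x m k i * (u - x) $ i * w u $ m $ j))"
        by (rule sum.swap)
      also have "p $ j - (\<Sum>k\<in>UNIV. \<xi> $ k * w u $ k $ j) + \<dots> = (\<Sum>k\<in>UNIV. \<xi> $ k * R k j x u)"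
        by (simp add: p_def R_def distrib_left right_diff_distrib sum.distrib sum_subtractf sum_distrib_left)
      finally show ?thesis .
    qed
    have "norm (E v* w u) \<le> (\<Sum>j\<in>UNIV. \<bar>(E v* w u) $ j\<bar>)" by (rule norm_le_l1_cart)
    also have "\<dots> \<le> (\<Sum>j\<in>(UNIV::'d set). \<Sum>k\<in>(UNIV::'d set). norm \<xi> * (\<eta> * norm (u - x)))"
    proof (intro sum_mono)
      fix j
      have "\<bar>R k j x u\<bar> \<le> \<eta> * norm (u - x)" for k
        using d(2)[OF xu(1,2), of k j] xu(3) \<delta>_le[of k j] by linarith
      then show "\<bar>(E v* w u) $ j\<bar> \<le> (\<Sum>k\<in>(UNIV::'d set). norm \<xi> * (\<eta> * norm (u - x)))"
        unfolding E_w by (intro order_trans[OF sum_abs] sum_mono)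
          (auto simp: abs_mult intro!: mult_mono component_le_norm_cart)
    qed
    also have "\<dots> = e / C * norm \<xi> * norm (u - x)" by (simp add: \<eta>_def)
    finally have "C * norm (E v* w u) \<le> C * (e / C * norm \<xi> * norm (u - x))"
      using C(1) by (intro mult_left_mono) auto
    with C(2)[OF xu(2), of E] have "norm E \<le> e * norm \<xi> * norm (u - x)" using C(1) by simp
    then show "norm (ether_field \<omega> H c (chart_inv c x) ((1/2) *\<^sub>R \<xi>) c (chart_inv c u) - \<xi>
        + christoffel_map \<Gamma> c (chart_inv c x) \<xi> (u - x)) \<le> e * norm \<xi> * norm (u - x)"
      by (simp add: E_def f_def)
  qed
qed

section \<open>Tangent vectors and differentials of maps\<close>

lemma atlas_chart: "smooth_atlas A \<Longrightarrow> c \<in> A \<Longrightarrow> is_chart c"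
  unfolding smooth_atlas_def by blast

text \<open>The matrix of coordinate derivatives is the derivative of the transition map, which turns
  the transformation laws into instances of the chain rule.\<close>
lemma transition_has_derivative:
  fixes A :: "('m::{t2_space,second_countable_topology}, 'd::finite) chart set"
  assumes A: "smooth_atlas A" "c \<in> A" "c' \<in> A" and p: "p \<in> chart_dom c" "p \<in> chart_dom c'"
  shows "((coords c' \<circ> chart_inv c) has_derivative (*v) (jacobian c c' p)) (at (coords c p))"
proof -
  define T where "T = frechet_derivative (coords c' \<circ> chart_inv c) (at (coords c p))"
  have T: "((coords c' \<circ> chart_inv c) has_derivative T) (at (coords c p))"
    unfolding T_def using A p by (intro smooth_on_has_derivative) (auto simp: smooth_atlas_def)
  have "jacobian c c' p $ m $ k = T (axis k 1) $ m" for m k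
  proof -
    have "(((\<lambda>q. coords c' q $ m) \<circ> chart_inv c) has_derivative (\<lambda>v. T v $ m)) (at (coords c p))"
      using bounded_linear.has_derivative[OF bounded_linear_vec_nth T] by (simp add: o_def)
    then show ?thesis
      by (simp add: jacobian_def coord_deriv_def flip: frechet_derivative_at)
  qed
  then have "jacobian c c' p = matrix T" by (simp add: vec_eq_iff matrix_def)
  then have "(*v) (jacobian c c' p) = T"
    using matrix_vector_mul(2)[OF has_derivative_linear[OF T]] by simp
  with T show ?thesis by simp
qed

lemma change_target_chart:
  fixes A :: "('m::{t2_space,second_countable_topology}, 'd::finite) chart set"
  assumes A: "smooth_atlas A" "c0 \<in> A" "c \<in> A" "c' \<in> A"
    and p: "p \<in> chart_dom c0" "F p \<in> chart_dom c" "F p \<in> chart_dom c'" and cont: "isCont F p"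
    and D: "((coords c \<circ> F \<circ> chart_inv c0) has_derivative D) (at (coords c0 p))"
  shows "((coords c' \<circ> F \<circ> chart_inv c0) has_derivative (\<lambda>v. jacobian c c' (F p) *v D v)) (at (coords c0 p))"
proof -
  note c0 = atlas_chart[OF A(1,2)] and c = atlas_chart[OF A(1,3)]
  have p_eq: "chart_inv c0 (coords c0 p) = p" by (rule chart_inv_coords[OF c0 p(1)])
  have "((coords c' \<circ> chart_inv c) has_derivative (*v) (jacobian c c' (F p)))
      (at ((coords c \<circ> F \<circ> chart_inv c0) (coords c0 p)))"
    using transition_has_derivative[OF A(1,3,4) p(2,3)] p_eq by simp
  from has_derivative_compose[OF D this]
  have "((\<lambda>\<xi>. (coords c' \<circ> chart_inv c) ((coords c \<circ> F \<circ> chart_inv c0) \<xi>))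
      has_derivative (\<lambda>v. jacobian c c' (F p) *v D v)) (at (coords c0 p))" .
  moreover have "(\<lambda>\<xi>. F (chart_inv c0 \<xi>)) \<midarrow>coords c0 p\<rightarrow> F p"
    using isCont_chart_inv[OF c0 coords_in_img[OF p(1)]] cont p_eq
    by (metis isCont_def isCont_tendsto_compose)
  then have "\<forall>\<^sub>F \<xi> in at (coords c0 p). F (chart_inv c0 \<xi>) \<in> chart_dom c"
    by (rule topological_tendstoD[OF _ open_chart_dom[OF c] p(2)])
  then have "\<forall>\<^sub>F \<xi> in at (coords c0 p).
      (coords c' \<circ> chart_inv c) ((coords c \<circ> F \<circ> chart_inv c0) \<xi>) = (coords c' \<circ> F \<circ> chart_inv c0) \<xi>"
    by eventually_elim (simp add: chart_inv_coords[OF c])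
  ultimately show ?thesis
    by (rule has_derivative_transform_eventually) (simp_all add: p_eq chart_inv_coords[OF c p(2)])
qed

text \<open>The same choice as in the definition of \<open>differential\<close>, so that the two unfold to each other.\<close>
definition chart_at :: "('m, 'd) chart set \<Rightarrow> 'm \<Rightarrow> ('m, 'd) chart" where
  "chart_at A p = (SOME c. c \<in> A \<and> p \<in> chart_dom c)"

lemma chart_at:
  assumes "smooth_atlas A" shows "chart_at A p \<in> A" "p \<in> chart_dom (chart_at A p)"
proof -
  have "\<exists>c. c \<in> A \<and> p \<in> chart_dom c" using assms unfolding smooth_atlas_def by blast
  from someI_ex[OF this] show "chart_at A p \<in> A" "p \<in> chart_dom (chart_at A p)"
    unfolding chart_at_def by auto
qed

lemma differential_apply:
  assumes "c' \<in> A" "F p \<in> chart_dom c'"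
    and "((coords c' \<circ> F \<circ> chart_inv (chart_at A p)) has_derivative D) (at (coords (chart_at A p) p))"
  shows "differential A F p v c' = D (v (chart_at A p))"
  using assms(1,2) frechet_derivative_at[OF assms(3)]
  by (simp add: differential_def Let_def chart_at_def)

lemma map_differentiable_atD:
  assumes "map_differentiable_at A F p" "c \<in> A" "c' \<in> A" "p \<in> chart_dom c" "F p \<in> chart_dom c'"
  shows "((coords c' \<circ> F \<circ> chart_inv c) has_derivative
    frechet_derivative (coords c' \<circ> F \<circ> chart_inv c) (at (coords c p))) (at (coords c p))"
  using assms unfolding map_differentiable_at_def frechet_derivative_works by blast

lemma tangent_spaceD:
  assumes "v \<in> tangent_space A p"
  shows "c \<in> A \<Longrightarrow> c' \<in> A \<Longrightarrow> p \<in> chart_dom c \<Longrightarrow> p \<in> chart_dom c' \<Longrightarrow> v c' = jacobian c c' p *v v c"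
    and "c \<notin> A \<or> p \<notin> chart_dom c \<Longrightarrow> v c = 0"
  using assms unfolding tangent_space_def by blast+

text \<open>The transformation law is the chain rule for a change of the target chart.\<close>
lemma differential_in_tangent_space:
  fixes A :: "('m::{t2_space,second_countable_topology}, 'd::finite) chart set"
  assumes A: "smooth_atlas A" and F: "map_differentiable_at A F p"
  shows "differential A F p v \<in> tangent_space A (F p)"
  unfolding tangent_space_def
proof (intro CollectI conjI ballI impI allI)
  fix c c' assume c: "c \<in> A" "c' \<in> A" and Fp: "F p \<in> chart_dom c \<inter> chart_dom c'"
  define c0 where "c0 = chart_at A p"
  note c0 = chart_at[OF A, of p, folded c0_def]
  have D: "((coords c \<circ> F \<circ> chart_inv c0) has_derivative
      frechet_derivative (coords c \<circ> F \<circ> chart_inv c0) (at (coords c0 p))) (at (coords c0 p))"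
    using map_differentiable_atD[OF F c0(1) c(1) c0(2)] Fp by blast
  moreover have "((coords c' \<circ> F \<circ> chart_inv c0) has_derivative (\<lambda>v. jacobian c c' (F p) *v
      frechet_derivative (coords c \<circ> F \<circ> chart_inv c0) (at (coords c0 p)) v)) (at (coords c0 p))"
    using F Fp by (intro change_target_chart[OF A c0(1) c c0(2) _ _ _ D])
      (auto simp: map_differentiable_at_def)
  ultimately show "differential A F p v c' = jacobian c c' (F p) *v differential A F p v c"
    using differential_apply[of c A F p _ v] differential_apply[of c' A F p _ v] c Fp
    unfolding c0_def by fastforce
qed (auto simp: differential_def)

lemma differential_id:
  fixes A :: "('m::{t2_space,second_countable_topology}, 'd::finite) chart set"
  assumes A: "smooth_atlas A" and v: "v \<in> tangent_space A p"
  shows "differential A (\<lambda>q. q) p v = v"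
proof
  fix c' show "differential A (\<lambda>q. q) p v c' = v c'"
  proof (cases "c' \<in> A \<and> p \<in> chart_dom c'")
    case True
    define c0 where "c0 = chart_at A p"
    note c0 = chart_at[OF A, of p, folded c0_def]
    have "((coords c' \<circ> (\<lambda>q. q) \<circ> chart_inv c0) has_derivative (*v) (jacobian c0 c' p)) (at (coords c0 p))"
      using transition_has_derivative[OF A c0(1) _ c0(2), of c'] True by (simp add: o_def)
    then have "differential A (\<lambda>q. q) p v c' = jacobian c0 c' p *v v c0"
      using True unfolding c0_def by (intro differential_apply) auto
    also have "\<dots> = v c'" using tangent_spaceD(1)[OF v c0(1) _ c0(2), of c'] True by metis
    finally show ?thesis .
  next
    case False
    then have "v c' = 0" using tangent_spaceD(2)[OF v] by blast
    moreover have "differential A (\<lambda>q. q) p v c' = 0" using False by (auto simp: differential_def)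
    ultimately show ?thesis by simp
  qed
qed

lemma map_differentiable_at_id:
  fixes A :: "('m::{t2_space,second_countable_topology}, 'd::finite) chart set"
  assumes "smooth_atlas A"
  shows "map_differentiable_at A (\<lambda>q. q) p"
  unfolding map_differentiable_at_def differentiable_def
  using transition_has_derivative[OF assms] by (fastforce simp: o_def)

lemma tangent_space_eqI:
  assumes "v \<in> tangent_space A p" "w \<in> tangent_space A p" "c \<in> A" "p \<in> chart_dom c" "v c = w c"
  shows "v = w"
proof
  fix c' show "v c' = w c'"
  proof (cases "c' \<in> A \<and> p \<in> chart_dom c'")
    case True
    then show ?thesis
      using tangent_spaceD(1)[OF assms(1,3) _ assms(4)] tangent_spaceD(1)[OF assms(2,3) _ assms(4)] assms(5)
      by metis
  next
    case False
    then show ?thesis using tangent_spaceD(2)[OF assms(1)] tangent_spaceD(2)[OF assms(2)] by metis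
  qed
qed

section \<open>Parallel translation along a path\<close>

text \<open>The equation of parallel translation reads \<open>W' = transport_generator \<Gamma> c y t W\<close>. Bounded linear
  maps carry the norm that is needed for Gronwall's inequality and for Picard iteration.\<close>
definition transport_generator ::
  "('m, 'd::finite) christoffel \<Rightarrow> ('m, 'd) chart \<Rightarrow> (real \<Rightarrow> 'm) \<Rightarrow> real \<Rightarrow> (real ^ 'd) \<Rightarrow>\<^sub>L (real ^ 'd)"
  where "transport_generator \<Gamma> c y t = Blinfun (\<lambda>w. - christoffel_map \<Gamma> c (y t) (velocity c y t) w)"

lemma transport_generator_apply:
  "blinfun_apply (transport_generator \<Gamma> c y t) w = - christoffel_map \<Gamma> c (y t) (velocity c y t) w"
proof -
  have "linear (\<lambda>w. - christoffel_map \<Gamma> c (y t) (velocity c y t) w)"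
    by (rule linearI) (auto simp: christoffel_map_def vec_eq_iff algebra_simps sum.distrib sum_distrib_left)
  then show ?thesis
    unfolding transport_generator_def
    by (subst bounded_linear_Blinfun_apply) (auto simp: linear_conv_bounded_linear)
qed

lemma parallel_along_iff:
  "parallel_along A \<Gamma> y t W \<longleftrightarrow>
     (\<forall>\<tau>\<in>{0..t}. W \<tau> \<in> tangent_space A (y \<tau>)) \<and>
     (\<forall>\<tau>\<in>{0..t}. \<forall>c\<in>A. y \<tau> \<in> chart_dom c \<longrightarrow>
        ((\<lambda>\<sigma>. W \<sigma> c) has_vector_derivative transport_generator \<Gamma> c y \<tau> (W \<tau> c)) (at \<tau> within {0..t}))"
proof -
  have "transport_generator \<Gamma> c y \<tau> w
      = (\<chi> m. - (\<Sum>i\<in>UNIV. \<Sum>j\<in>UNIV. \<Gamma> c (y \<tau>) m i j * velocity c y \<tau> $ i * w $ j))" for c \<tau> w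
    by (simp add: transport_generator_apply christoffel_map_def vec_eq_iff)
  then show ?thesis unfolding parallel_along_def by (simp only:)
qed

lemma smooth_path_in_chart:
  assumes y: "smooth_path A y" and c: "c \<in> A" and t: "t \<in> {0..1}" "y t \<in> chart_dom c"
  obtains d where "d > 0"
    and "\<And>\<tau>. \<tau> \<in> {0..1} \<inter> {t - d<..<t + d} \<Longrightarrow> y \<tau> \<in> chart_dom c"
    and "\<And>\<tau>. \<tau> \<in> {0..1} \<inter> {t - d<..<t + d} \<Longrightarrow>
      ((\<lambda>\<tau>. coords c (y \<tau>)) has_vector_derivative velocity c y \<tau>) (at \<tau> within {0..1})"
    and "continuous_on ({0..1} \<inter> {t - d<..<t + d}) (velocity c y)"
proof -
  from y c t obtain d g where d: "d > 0" and g: "smooth_on {t - d<..<t + d} g"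
    and eq: "\<And>\<tau>. \<tau> \<in> {t - d<..<t + d} \<inter> {0..1} \<Longrightarrow> y \<tau> \<in> chart_dom c \<and> coords c (y \<tau>) = g \<tau>"
    unfolding smooth_path_def by meson
  have deriv: "((\<lambda>\<tau>. coords c (y \<tau>)) has_vector_derivative frechet_derivative g (at \<tau>) 1) (at \<tau> within {0..1})"
    if \<tau>: "\<tau> \<in> {0..1} \<inter> {t - d<..<t + d}" for \<tau>
  proof -
    have "(g has_derivative frechet_derivative g (at \<tau>)) (at \<tau>)"
      using \<tau> by (intro smooth_on_has_derivative[OF g]) auto
    then have "(g has_vector_derivative frechet_derivative g (at \<tau>) 1) (at \<tau>)"
      by (metis frechet_derivative_works differentiableI vector_derivative_works
          has_vector_derivative_def scaleR_one frechet_derivative_at)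
    then have "(g has_vector_derivative frechet_derivative g (at \<tau>) 1) (at \<tau> within {0..1})"
      by (rule has_vector_derivative_at_within)
    moreover have "min (\<tau> - (t - d)) (t + d - \<tau>) > 0" using \<tau> by auto
    ultimately show ?thesis
    proof (rule has_vector_derivative_transform_within)
      show "\<tau> \<in> {0..1}" using \<tau> by simp
      fix x assume "x \<in> {0..1}" "dist x \<tau> < min (\<tau> - (t - d)) (t + d - \<tau>)"
      then have "x \<in> {t - d<..<t + d} \<inter> {0..1}" by (auto simp: dist_real_def abs_less_iff)
      then show "g x = coords c (y x)" using eq by simp
    qed
  qed
  have vel: "velocity c y \<tau> = frechet_derivative g (at \<tau>) 1" if \<tau>: "\<tau> \<in> {0..1} \<inter> {t - d<..<t + d}" for \<tau>
    unfolding velocity_def o_def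
    using \<tau> deriv[OF \<tau>] by (intro vector_derivative_within_closed_interval) auto
  have "continuous_on ({0..1} \<inter> {t - d<..<t + d}) (\<lambda>\<tau>. frechet_derivative g (at \<tau>) 1)"
    using continuous_on_frechet_derivative[OF g] by (rule continuous_on_subset) auto
  then have "continuous_on ({0..1} \<inter> {t - d<..<t + d}) (velocity c y)"
    by (rule continuous_on_eq) (simp add: vel)
  with that[OF d] eq deriv vel show thesis by auto
qed

text \<open>All data of the path near one of its points that the two applications of Gronwall's inequality
  need: for the uniqueness of parallel fields and for the linearisation of the flow.\<close>
lemma transport_generator_bounded:
  fixes A :: "('m::{t2_space,second_countable_topology}, 'd::finite) chart set"
  assumes A: "smooth_atlas A" and \<Gamma>: "affine_connection A \<Gamma>"
    and y: "smooth_path A y" and c: "c \<in> A" and t: "t \<in> {0..1}" "y t \<in> chart_dom c"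
  obtains d K V where "d > 0" and "K \<ge> 0" and "V \<ge> 0"
    and "\<And>\<tau>. \<tau> \<in> {0..1} \<inter> cball t d \<Longrightarrow> y \<tau> \<in> chart_dom c"
    and "\<And>\<tau>. \<tau> \<in> {0..1} \<inter> cball t d \<Longrightarrow>
      ((\<lambda>\<tau>. coords c (y \<tau>)) has_vector_derivative velocity c y \<tau>) (at \<tau> within {0..1})"
    and "continuous_on ({0..1} \<inter> cball t d) (transport_generator \<Gamma> c y)"
    and "\<And>\<tau>. \<tau> \<in> {0..1} \<inter> cball t d \<Longrightarrow> norm (transport_generator \<Gamma> c y \<tau>) \<le> K"
    and "\<And>\<tau>. \<tau> \<in> {0..1} \<inter> cball t d \<Longrightarrow> norm (velocity c y \<tau>) \<le> V"
proof -
  obtain d' where d': "d' > 0"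
    and dom': "\<And>\<tau>. \<tau> \<in> {0..1} \<inter> {t - d'<..<t + d'} \<Longrightarrow> y \<tau> \<in> chart_dom c"
    and deriv': "\<And>\<tau>. \<tau> \<in> {0..1} \<inter> {t - d'<..<t + d'} \<Longrightarrow>
      ((\<lambda>\<tau>. coords c (y \<tau>)) has_vector_derivative velocity c y \<tau>) (at \<tau> within {0..1})"
    and cont': "continuous_on ({0..1} \<inter> {t - d'<..<t + d'}) (velocity c y)"
    by (rule smooth_path_in_chart[OF y c t]) blast
  define I where "I = {0..1} \<inter> cball t (d' / 2)"
  have I: "I \<subseteq> {0..1} \<inter> {t - d'<..<t + d'}"
    using d' by (auto simp: I_def dist_real_def abs_if split: if_splits)
  have dom: "y \<tau> \<in> chart_dom c" if "\<tau> \<in> I" for \<tau> using dom' I that by blast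
  have deriv: "((\<lambda>\<tau>. coords c (y \<tau>)) has_vector_derivative velocity c y \<tau>) (at \<tau> within {0..1})"
    if "\<tau> \<in> I" for \<tau> using deriv' I that by blast
  have vel: "continuous_on I (velocity c y)" using cont' I by (rule continuous_on_subset)
  have "((\<lambda>\<tau>. coords c (y \<tau>)) has_vector_derivative velocity c y \<tau>) (at \<tau> within I)" if "\<tau> \<in> I" for \<tau>
    using deriv[OF that] by (rule has_vector_derivative_within_subset) (simp add: I_def)
  then have co: "continuous_on I (\<lambda>\<tau>. coords c (y \<tau>))" by (rule continuous_on_vector_derivative)
  have G: "continuous_on I (\<lambda>\<tau>. \<Gamma> c (y \<tau>) m i j)" for m i j
  proof -
    have "continuous_on (chart_img c) (\<lambda>u. \<Gamma> c (chart_inv c u) m i j)"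
      using \<Gamma> c unfolding affine_connection_def smooth_in_def o_def
      by (intro smooth_on_imp_continuous_on) blast
    then have "continuous_on I (\<lambda>\<tau>. \<Gamma> c (chart_inv c (coords c (y \<tau>))) m i j)"
      by (rule continuous_on_compose2[OF _ co]) (auto intro: coords_in_img dom)
    then show ?thesis
      by (rule continuous_on_eq) (simp add: chart_inv_coords[OF atlas_chart[OF A c] dom])
  qed
  have "continuous_on I (\<lambda>\<tau>. velocity c y \<tau> $ i)" for i
    using bounded_linear.continuous_on[OF bounded_linear_vec_nth vel] .
  with G have B: "continuous_on I (transport_generator \<Gamma> c y)"
    by (intro continuous_on_blinfun_componentwise, unfold transport_generator_apply christoffel_map_def)
      (intro continuous_on_minus continuous_on_vec_lambda continuous_on_sum continuous_on_mult
        continuous_on_const, auto)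
  have "compact I" unfolding I_def by (intro compact_Int) auto
  with B vel have "bounded (transport_generator \<Gamma> c y ` I)" "bounded (velocity c y ` I)"
    using compact_continuous_image compact_imp_bounded by blast+
  then obtain K V where "\<And>\<tau>. \<tau> \<in> I \<Longrightarrow> norm (transport_generator \<Gamma> c y \<tau>) \<le> K"
      "\<And>\<tau>. \<tau> \<in> I \<Longrightarrow> norm (velocity c y \<tau>) \<le> V"
    unfolding bounded_iff by (metis imageI)
  then have "norm (transport_generator \<Gamma> c y \<tau>) \<le> max K 0" "norm (velocity c y \<tau>) \<le> max V 0"
    if "\<tau> \<in> I" for \<tau> using that by (meson max.coboundedI1)+
  then show thesis
    using that[of "d'/2" "max K 0" "max V 0"] d' dom deriv B unfolding I_def by auto
qed

text \<open>In one chart, the difference of two solutions of a linear equation vanishes once it vanishes at one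
  point; a tangent vector is determined by its components in one chart, so the argument can
  change charts between the pieces of a subdivision.\<close>
lemma parallel_along_unique:
  fixes A :: "('m::{t2_space,second_countable_topology}, 'd::finite) chart set"
  assumes A: "smooth_atlas A" and \<Gamma>: "affine_connection A \<Gamma>" and y: "smooth_path A y"
    and t: "t \<in> {0..1}"
    and W: "parallel_along A \<Gamma> y t W1" "parallel_along A \<Gamma> y t W2" and init: "W1 0 = W2 0"
  shows "W1 t = W2 t"
proof -
  define P where "P a b \<longleftrightarrow> (0 \<le> a \<and> a \<le> b \<and> b \<le> t \<longrightarrow> W1 a = W2 a \<longrightarrow> W1 b = W2 b)" for a b
  have "0 \<le> t" using t by simp
  then have "P 0 t"
  proof (induction rule: Bolzano)
    case (trans a b c)
    then show ?case unfolding P_def by auto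
  next
    case (local x)
    define c where "c = chart_at A (y x)"
    note c = chart_at[OF A, of "y x", folded c_def]
    have x: "x \<in> {0..1}" using local t by simp
    from transport_generator_bounded[OF A \<Gamma> y c(1) x c(2)] obtain d K where d: "d > 0" and K: "K \<ge> 0"
      and dom: "\<And>\<tau>. \<tau> \<in> {0..1} \<inter> cball x d \<Longrightarrow> y \<tau> \<in> chart_dom c"
      and bound: "\<And>\<tau>. \<tau> \<in> {0..1} \<inter> cball x d \<Longrightarrow> norm (transport_generator \<Gamma> c y \<tau>) \<le> K"
      by metis
    show ?case
    proof (intro exI[of _ d] conjI allI impI d)
      fix a b assume ab: "a \<le> x \<and> x \<le> b \<and> b - a < d"
      show "P a b" unfolding P_def
      proof (intro impI)
        assume range: "0 \<le> a \<and> a \<le> b \<and> b \<le> t" and eq: "W1 a = W2 a"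
        have sub: "\<tau> \<in> {0..1} \<inter> cball x d" "\<tau> \<in> {0..t}" if "\<tau> \<in> {a..b}" for \<tau>
          using that ab range t by (auto simp: dist_real_def)
        define u where "u \<tau> = W1 \<tau> c - W2 \<tau> c" for \<tau>
        have W': "((\<lambda>\<sigma>. W \<sigma> c) has_vector_derivative transport_generator \<Gamma> c y \<tau> (W \<tau> c)) (at \<tau> within {a..b})"
          if "parallel_along A \<Gamma> y t W" "\<tau> \<in> {a..b}" for W \<tau>
        proof -
          have "y \<tau> \<in> chart_dom c" using dom sub(1)[OF that(2)] .
          then have "((\<lambda>\<sigma>. W \<sigma> c) has_vector_derivative transport_generator \<Gamma> c y \<tau> (W \<tau> c)) (at \<tau> within {0..t})"
            using that(1) sub(2)[OF that(2)] c(1) unfolding parallel_along_iff by blast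
          then show ?thesis
            by (rule has_vector_derivative_within_subset) (use range in auto)
        qed
        have "norm (u b) \<le> exp ((2 * K + 1) * (b - a)) * (norm (u a) + 0)"
        proof (rule gronwall_norm_bound[OF K order_refl])
          fix \<tau> assume \<tau>: "\<tau> \<in> {a..b}"
          show "(u has_vector_derivative transport_generator \<Gamma> c y \<tau> (u \<tau>)) (at \<tau> within {a..b})"
            unfolding u_def blinfun.diff_right
            by (intro has_vector_derivative_diff W'[OF W(1) \<tau>] W'[OF W(2) \<tau>])
          show "norm (transport_generator \<Gamma> c y \<tau> (u \<tau>)) \<le> K * norm (u \<tau>) + 0"
            using norm_blinfun[of "transport_generator \<Gamma> c y \<tau>" "u \<tau>"]
              mult_right_mono[OF bound[OF sub(1)[OF \<tau>]] norm_ge_zero[of "u \<tau>"]] by linarith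
        qed (use range in auto)
        then have "W1 b c = W2 b c" by (simp add: u_def eq)
        moreover have "b \<in> {a..b}" using range by simp
        ultimately show "W1 b = W2 b"
          using W sub[of b] dom[of b] c(1) unfolding parallel_along_iff
          by (intro tangent_space_eqI[of "W1 b" A "y b" "W2 b" c]) blast+
      qed
    qed
  qed
  then show ?thesis using t init by (simp add: P_def)
qed

section \<open>The flow along the path\<close>

locale ether_flow =
  fixes A :: "('m::{t2_space,second_countable_topology}, 'd::finite) chart set"
    and \<omega> :: "('m, 'd) tensor2" and \<Gamma> :: "('m, 'd) christoffel" and H :: "('m, 'd) fun_form"
    and y :: "real \<Rightarrow> 'm" and Y :: "real \<Rightarrow> 'm \<Rightarrow> 'm"
  assumes atlas: "smooth_atlas A"
    and symplectic: "symplectic_form A \<omega>"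
    and connection: "affine_connection A \<Gamma>" "torsion_free A \<Gamma>" "parallel_form A \<Gamma> \<omega>"
    and ether: "smooth_fun_form A H" "diagonal_conditions A \<omega> \<Gamma> H"
    and path: "smooth_path A y"
    and flow: "translation_flow A \<omega> H y Y"
begin

lemma flow_deriv:
  assumes "t \<in> {0..1}" "c \<in> A" "y t \<in> chart_dom c" "Y t x \<in> chart_dom c"
  shows "((\<lambda>\<tau>. coords c (Y \<tau> x)) has_vector_derivative
    ether_field \<omega> H c (y t) ((1/2) *\<^sub>R velocity c y t) c (Y t x)) (at t within {0..1})"
  using flow assms unfolding translation_flow_def by blast

lemma flow_cont: "continuous_on {0..1} (\<lambda>t. Y t x)"
  and flow_0: "Y 0 x = x"
  using flow unfolding translation_flow_def by auto

text \<open>On a piece \<open>{a..b}\<close> of the path inside one chart, the deviation of a neighbouring trajectory from the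
  path is bounded by its value at time \<open>a\<close>, and it is transported by \<open>M\<close> up to a small fraction of
  that value. The argument is circular only in appearance: the linearisation of the field holds
  in a tube around the path, and inside the tube the resulting estimate is strictly better
  than what membership in the tube requires.\<close>
lemma flow_linearisation:
  assumes c: "c \<in> A" and ab: "a \<le> b" "{a..b} \<subseteq> {0..1}"
    and dom: "\<And>t. t \<in> {a..b} \<Longrightarrow> y t \<in> chart_dom c"
    and g': "\<And>t. t \<in> {a..b} \<Longrightarrow>
      ((\<lambda>t. coords c (y t)) has_vector_derivative velocity c y t) (at t within {a..b})"
    and S: "compact S" "convex S" "S \<subseteq> chart_img c"
    and \<rho>: "\<rho> > 0" "\<And>t. t \<in> {a..b} \<Longrightarrow> cball (coords c (y t)) \<rho> \<subseteq> S"
    and K: "K \<ge> 0" "\<And>t. t \<in> {a..b} \<Longrightarrow> norm (transport_generator \<Gamma> c y t) \<le> K"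
    and V: "V \<ge> 0" "\<And>t. t \<in> {a..b} \<Longrightarrow> norm (velocity c y t) \<le> V"
    and M: "M a = id_blinfun" "\<And>t. t \<in> {a..b} \<Longrightarrow>
      (M has_vector_derivative (transport_generator \<Gamma> c y t o\<^sub>L M t)) (at t within {a..b})"
    and e: "0 < e" "e \<le> 1"
  defines "C \<equiv> exp ((2 * (K + 1) + 1) * (b - a))"
  obtains s where "s > 0"
    and "\<And>x t. Y a x \<in> chart_dom c \<Longrightarrow> norm (coords c (Y a x) - coords c (y a)) < s \<Longrightarrow> t \<in> {a..b} \<Longrightarrow>
      Y t x \<in> chart_dom c \<and>
      norm (coords c (Y t x) - coords c (y t)) \<le> C * norm (coords c (Y a x) - coords c (y a)) \<and>
      norm (coords c (Y t x) - coords c (y t) - M t (coords c (Y a x) - coords c (y a)))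
        \<le> e * C\<^sup>2 * norm (coords c (Y a x) - coords c (y a))"
proof -
  define g where "g t = coords c (y t)" for t
  have chart: "is_chart c" using atlas c by (rule atlas_chart)
  have y_eq: "chart_inv c (g t) = y t" if "t \<in> {a..b}" for t
    unfolding g_def using chart_inv_coords[OF chart dom[OF that]] .
  have "e / (V + 1) > 0" using e V by simp
  then obtain \<delta> where \<delta>: "\<delta> > 0"
    and lin: "\<And>x u \<xi>. x \<in> S \<Longrightarrow> u \<in> S \<Longrightarrow> dist x u \<le> \<delta> \<Longrightarrow>
      norm (ether_field \<omega> H c (chart_inv c x) ((1/2) *\<^sub>R \<xi>) c (chart_inv c u) - \<xi>
        + christoffel_map \<Gamma> c (chart_inv c x) \<xi> (u - x)) \<le> e / (V + 1) * norm \<xi> * norm (u - x)"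
    using ether_field_linearisation[OF chart c symplectic connection ether S] by metis
  define r where "r = min \<rho> \<delta>"
  have r: "r > 0" using \<rho> \<delta> by (simp add: r_def)
  have C: "C \<ge> 1" unfolding C_def using ab K by simp
  \<comment> \<open>deviations grow at most by the factor \<open>C\<close>, so they stay below \<open>r / 2\<close>\<close>
  define s where "s = r / (2 * C)"
  have s: "s > 0" "C * s = r / 2" using r C by (auto simp: s_def)
  have tube: "w \<in> S" if "t \<in> {a..b}" "norm (w - g t) \<le> r" for t w
    using \<rho>(2)[OF that(1)] that(2) by (auto simp: r_def g_def dist_norm norm_minus_commute)
  have g_cont: "continuous_on {a..b} g"
    unfolding g_def by (rule continuous_on_vector_derivative) (rule g')
  \<comment> \<open>as long as the trajectory stays in the tube, it obeys the linearised equation up to \<open>e\<close>\<close>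
  have in_tube: "norm (coords c (Y t x) - g t) \<le> C * norm (coords c (Y a x) - g a)"
      "norm (coords c (Y t x) - g t - M t (coords c (Y a x) - g a)) \<le> e * C\<^sup>2 * norm (coords c (Y a x) - g a)"
    if t: "t \<in> {a..b}"
      and stay: "\<And>\<sigma>. \<sigma> \<in> {a..t} \<Longrightarrow> Y \<sigma> x \<in> chart_dom c \<and> norm (coords c (Y \<sigma> x) - g \<sigma>) \<le> r" for t x
  proof -
    define u where "u \<tau> = coords c (Y \<tau> x)" for \<tau>
    define u' where "u' \<tau> = ether_field \<omega> H c (y \<tau>) ((1/2) *\<^sub>R velocity c y \<tau>) c (Y \<tau> x)" for \<tau>
    have sub: "{a..t} \<subseteq> {a..b}" using t by auto
    have u_deriv: "(u has_vector_derivative u' \<tau>) (at \<tau> within {a..t})" if "\<tau> \<in> {a..t}" for \<tau>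
      unfolding u_def u'_def
      by (rule has_vector_derivative_within_subset[OF flow_deriv])
        (use that sub ab c dom stay in auto)
    have g_deriv: "(g has_vector_derivative velocity c y \<tau>) (at \<tau> within {a..t})" if "\<tau> \<in> {a..t}" for \<tau>
      unfolding g_def using that sub by (intro has_vector_derivative_within_subset[OF g']) auto
    have M_deriv: "(M has_vector_derivative (transport_generator \<Gamma> c y \<tau> o\<^sub>L M \<tau>)) (at \<tau> within {a..t})"
      if "\<tau> \<in> {a..t}" for \<tau>
      using that sub by (intro has_vector_derivative_within_subset[OF M(2)]) auto
    have bound: "norm (transport_generator \<Gamma> c y \<tau>) \<le> K" if "\<tau> \<in> {a..t}" for \<tau>
      using that sub K(2) by blast
    have err: "norm (u' \<tau> - velocity c y \<tau> - transport_generator \<Gamma> c y \<tau> (u \<tau> - g \<tau>)) \<le> e * norm (u \<tau> - g \<tau>)"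
      if \<tau>: "\<tau> \<in> {a..t}" for \<tau>
    proof -
      have \<tau>': "\<tau> \<in> {a..b}" using \<tau> sub by blast
      have Y_eq: "chart_inv c (u \<tau>) = Y \<tau> x"
        unfolding u_def using chart_inv_coords[OF chart] stay[OF \<tau>] by blast
      have "g \<tau> \<in> S" "u \<tau> \<in> S"
        using tube[OF \<tau>', of "g \<tau>"] tube[OF \<tau>', of "u \<tau>"] stay[OF \<tau>] r by (auto simp: u_def)
      moreover have "dist (g \<tau>) (u \<tau>) \<le> \<delta>"
        using stay[OF \<tau>] by (simp add: dist_norm norm_minus_commute u_def r_def)
      ultimately have "norm (u' \<tau> - velocity c y \<tau> - transport_generator \<Gamma> c y \<tau> (u \<tau> - g \<tau>))
          \<le> e / (V + 1) * norm (velocity c y \<tau>) * norm (u \<tau> - g \<tau>)"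
        using lin[of "g \<tau>" "u \<tau>" "velocity c y \<tau>"]
        by (simp add: y_eq[OF \<tau>'] Y_eq u'_def transport_generator_apply)
      also have "\<dots> \<le> e * norm (u \<tau> - g \<tau>)"
      proof (rule mult_right_mono)
        have "e / (V + 1) * norm (velocity c y \<tau>) \<le> e / (V + 1) * (V + 1)"
          using V(2)[OF \<tau>'] e V(1) by (intro mult_left_mono) auto
        then show "e / (V + 1) * norm (velocity c y \<tau>) \<le> e" using V(1) by simp
      qed simp
      finally show ?thesis .
    qed
    have "a \<le> t" "0 \<le> e" "t \<in> {a..t}" using t e by auto
    note est = linearisation_error[OF this(1) K(1) this(2) bound M(1) M_deriv g_deriv u_deriv err this(3)]
    have exp_le: "exp ((2 * (K + e) + 1) * (t - a)) \<le> C"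
      unfolding C_def using t e K(1) by (auto intro!: mult_mono)
    have "norm (u t - g t) \<le> exp ((2 * (K + e) + 1) * (t - a)) * norm (u a - g a)" by (rule est(1))
    also have "\<dots> \<le> C * norm (u a - g a)" by (intro mult_right_mono exp_le) simp
    finally show "norm (coords c (Y t x) - g t) \<le> C * norm (coords c (Y a x) - g a)" by (simp add: u_def)
    have "norm (u t - g t - M t (u a - g a))
        \<le> e * (exp ((2 * (K + e) + 1) * (t - a)))\<^sup>2 * norm (u a - g a)" by (rule est(2))
    also have "\<dots> \<le> e * C\<^sup>2 * norm (u a - g a)"
      using e by (intro mult_right_mono mult_left_mono power_mono exp_le) auto
    finally show "norm (coords c (Y t x) - g t - M t (coords c (Y a x) - g a))
        \<le> e * C\<^sup>2 * norm (coords c (Y a x) - g a)" by (simp add: u_def)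
  qed
  show thesis
  proof (rule that[OF s(1)])
    fix x t assume x: "Y a x \<in> chart_dom c" "norm (coords c (Y a x) - coords c (y a)) < s"
      and t: "t \<in> {a..b}"
    have small: "C * norm (coords c (Y a x) - g a) \<le> r / 2"
      using x(2) C unfolding s(2)[symmetric] g_def by (intro mult_left_mono) auto
    have stays: "Y \<tau> x \<in> chart_dom c \<and> norm (coords c (Y \<tau> x) - g \<tau>) \<le> r" if "\<tau> \<in> {a..b}" for \<tau>
    proof (rule stays_in_tube[where \<gamma> = "\<lambda>\<tau>. Y \<tau> x" and g = g and q = "r / 2",
          OF chart _ g_cont S(1,3) tube x(1) _ _ _ that])
      show "continuous_on {a..b} (\<lambda>\<tau>. Y \<tau> x)" using flow_cont ab(2) by (rule continuous_on_subset)
      have "1 * norm (coords c (Y a x) - g a) \<le> C * norm (coords c (Y a x) - g a)"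
        using C by (intro mult_right_mono) auto
      then show "norm (coords c (Y a x) - g a) \<le> r" using small r by simp
      show "r / 2 < r" using r by simp
      show "norm (coords c (Y \<tau> x) - g \<tau>) \<le> r / 2"
        if "\<tau> \<in> {a..b}" "\<And>\<sigma>. \<sigma> \<in> {a..\<tau>} \<Longrightarrow> Y \<sigma> x \<in> chart_dom c \<and> norm (coords c (Y \<sigma> x) - g \<sigma>) \<le> r" for \<tau>
        using in_tube(1)[OF that] small by linarith
    qed
    then have "\<And>\<sigma>. \<sigma> \<in> {a..t} \<Longrightarrow> Y \<sigma> x \<in> chart_dom c \<and> norm (coords c (Y \<sigma> x) - g \<sigma>) \<le> r"
      using t by simp
    from in_tube[OF t this] stays[OF t]
    show "Y t x \<in> chart_dom c \<and>
      norm (coords c (Y t x) - coords c (y t)) \<le> C * norm (coords c (Y a x) - coords c (y a)) \<and>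
      norm (coords c (Y t x) - coords c (y t) - M t (coords c (Y a x) - coords c (y a)))
        \<le> e * C\<^sup>2 * norm (coords c (Y a x) - coords c (y a))"
      by (simp add: g_def)
  qed
qed

text \<open>The property propagated along the path. Differentiability is part of it because the
  linearisation on a piece composes with the differential at its left end.\<close>
definition tracks :: "real \<Rightarrow> bool" where
  "tracks t \<longleftrightarrow> Y t (y 0) = y t \<and> map_differentiable_at A (Y t) (y 0)"

text \<open>The distance \<open>d\<close> is chosen such that the path stays in the concentric half of a ball inside the chart,
  which leaves room for the tube, and such that the fundamental solution exists. In the
  chart, the differential at a time of the piece is the fundamental solution composed with
  the differential at the left end, and inherits its differential equation.\<close>
lemma tracks_locally:
  assumes t0: "t0 \<in> {0..1}" and c: "c \<in> A" "y t0 \<in> chart_dom c"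
  obtains d where "d > 0"
    and "\<And>a b t. {a..b} \<subseteq> {0..1} \<inter> cball t0 d \<Longrightarrow> tracks a \<Longrightarrow> t \<in> {a..b} \<Longrightarrow> tracks t"
    and "\<And>a b t v. {a..b} \<subseteq> {0..1} \<inter> cball t0 d \<Longrightarrow> tracks a \<Longrightarrow> t \<in> {a..b} \<Longrightarrow>
      ((\<lambda>\<tau>. differential A (Y \<tau>) (y 0) v c) has_vector_derivative
        transport_generator \<Gamma> c y t (differential A (Y t) (y 0) v c)) (at t within {a..b})"
proof -
  have chart: "is_chart c" using atlas c(1) by (rule atlas_chart)
  obtain d1 K V where d1: "d1 > 0" and K: "K \<ge> 0" and V: "V \<ge> 0"
    and dom: "\<And>\<tau>. \<tau> \<in> {0..1} \<inter> cball t0 d1 \<Longrightarrow> y \<tau> \<in> chart_dom c"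
    and g': "\<And>\<tau>. \<tau> \<in> {0..1} \<inter> cball t0 d1 \<Longrightarrow>
      ((\<lambda>\<tau>. coords c (y \<tau>)) has_vector_derivative velocity c y \<tau>) (at \<tau> within {0..1})"
    and B: "continuous_on ({0..1} \<inter> cball t0 d1) (transport_generator \<Gamma> c y)"
    and BK: "\<And>\<tau>. \<tau> \<in> {0..1} \<inter> cball t0 d1 \<Longrightarrow> norm (transport_generator \<Gamma> c y \<tau>) \<le> K"
    and BV: "\<And>\<tau>. \<tau> \<in> {0..1} \<inter> cball t0 d1 \<Longrightarrow> norm (velocity c y \<tau>) \<le> V"
    by (rule transport_generator_bounded[OF atlas connection(1) path c(1) t0 c(2)]) blast
  define g where "g t = coords c (y t)" for t
  obtain \<rho>2 where \<rho>2: "\<rho>2 > 0" "cball (g t0) \<rho>2 \<subseteq> chart_img c"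
    using open_chart_img[OF chart] coords_in_img[OF c(2)] unfolding open_contains_cball g_def by blast
  define \<rho> where "\<rho> = \<rho>2 / 2"
  define S where "S = cball (g t0) (2 * \<rho>)"
  have \<rho>: "\<rho> > 0" and S: "compact S" "convex S" "S \<subseteq> chart_img c"
    using \<rho>2 by (auto simp: \<rho>_def S_def)
  have "(g has_vector_derivative velocity c y t0) (at t0 within {0..1})"
    unfolding g_def using d1 t0 by (intro g') auto
  then have "continuous (at t0 within {0..1}) g" by (rule has_vector_derivative_continuous)
  then obtain d2 where d2: "d2 > 0" "\<And>\<tau>. \<tau> \<in> {0..1} \<Longrightarrow> dist \<tau> t0 < d2 \<Longrightarrow> dist (g \<tau>) (g t0) < \<rho>"
    using \<rho> unfolding continuous_within_eps_delta by blast
  \<comment> \<open>an interval in \<open>cball t0 d\<close> has length at most \<open>2 d\<close>, short enough for the fundamental solution\<close>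
  define d where "d = min (min d1 (d2 / 2)) (1 / (4 * (K + 1)))"
  have d: "d > 0" "d \<le> d1" "d < d2" using d1 d2(1) K by (auto simp: d_def)
  have Kd: "K * (2 * d) \<le> 1 / 2"
  proof -
    have "K * (2 * d) \<le> (K + 1) * (2 * (1 / (4 * (K + 1))))"
      using K d by (intro mult_mono) (auto simp: d_def)
    also have "\<dots> = 1 / 2" using K by (simp add: field_simps)
    finally show ?thesis .
  qed
  have main: "tracks t" (is ?tracks) "((\<lambda>\<tau>. differential A (Y \<tau>) (y 0) v c) has_vector_derivative
        transport_generator \<Gamma> c y t (differential A (Y t) (y 0) v c)) (at t within {a..b})" (is ?deriv)
    if sub: "{a..b} \<subseteq> {0..1} \<inter> cball t0 d" and tr: "tracks a" and t: "t \<in> {a..b}" for a b t v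
  proof -
    have ab: "a \<le> b" using t by simp
    have sub1: "{a..b} \<subseteq> {0..1} \<inter> cball t0 d1" using sub d(2) by auto
    have sub01: "{a..b} \<subseteq> {0..1}" using sub by blast
    have dom_ab: "y \<tau> \<in> chart_dom c" if "\<tau> \<in> {a..b}" for \<tau> using dom sub1 that by blast
    have "b - a \<le> 2 * d"
    proof -
      have "a \<in> cball t0 d" "b \<in> cball t0 d" using sub ab by auto
      then show ?thesis by (auto simp: dist_real_def)
    qed
    then have short: "K * (b - a) \<le> 1 / 2" using mult_left_mono[OF _ K] Kd by fastforce
    obtain M where M0: "M a = id_blinfun" and M: "\<And>\<tau>. \<tau> \<in> {a..b} \<Longrightarrow>
        (M has_vector_derivative (transport_generator \<Gamma> c y \<tau> o\<^sub>L M \<tau>)) (at \<tau> within {a..b})"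
      using fundamental_solution[OF ab continuous_on_subset[OF B sub1] _ short] BK sub1 by blast
    have g'_ab: "((\<lambda>\<tau>. coords c (y \<tau>)) has_vector_derivative velocity c y \<tau>) (at \<tau> within {a..b})"
      if "\<tau> \<in> {a..b}" for \<tau>
      using that sub1 sub01 by (intro has_vector_derivative_within_subset[OF g']) auto
    have tube: "cball (coords c (y \<tau>)) \<rho> \<subseteq> S" if "\<tau> \<in> {a..b}" for \<tau>
    proof -
      have "dist \<tau> t0 < d2" "\<tau> \<in> {0..1}" using that sub d(3) by (auto simp: dist_commute)
      then have "dist (g \<tau>) (g t0) < \<rho>" using d2(2) by blast
      then show ?thesis unfolding S_def g_def[symmetric] by (intro cball_subset_cball_iff[THEN iffD2]) simp
    qed
    have BK': "norm (transport_generator \<Gamma> c y \<tau>) \<le> K" "norm (velocity c y \<tau>) \<le> V" if "\<tau> \<in> {a..b}" for \<tau>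
      using that sub1 BK BV by blast+
    define C where "C = exp ((2 * (K + 1) + 1) * (b - a))"
    have "C > 0" by (simp add: C_def)
    have lin: "\<exists>s>0. \<forall>x t. Y a x \<in> chart_dom c \<longrightarrow> norm (coords c (Y a x) - g a) < s \<longrightarrow> t \<in> {a..b} \<longrightarrow>
        Y t x \<in> chart_dom c \<and> norm (coords c (Y t x) - g t) \<le> C * norm (coords c (Y a x) - g a) \<and>
        norm (coords c (Y t x) - g t - M t (coords c (Y a x) - g a)) \<le> e * C\<^sup>2 * norm (coords c (Y a x) - g a)"
      if "0 < e" "e \<le> 1" for e
      unfolding g_def C_def
      by (rule flow_linearisation[OF c(1) ab sub01 dom_ab g'_ab S \<rho> tube K BK'(1) V BK'(2) M0 M that]) blast+
    have a_in: "a \<in> {a..b}" using ab by simp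
    have Ya: "Y a (y 0) = y a" "isCont (Y a) (y 0)"
      using tr unfolding tracks_def map_differentiable_at_def by auto
    have Ya_dom: "Y a (y 0) \<in> chart_dom c" using Ya dom_ab[OF a_in] by simp
    have lim_a: "((\<lambda>x. coords c (Y a x)) \<longlongrightarrow> g a) (at (y 0))"
      using tendsto_coords[OF chart Ya(2)[unfolded isCont_def] Ya_dom] Ya(1) by (simp add: g_def)
    have near_a: "\<forall>\<^sub>F x in at (y 0). Y a x \<in> chart_dom c \<and> norm (coords c (Y a x) - g a) < s" if "s > 0" for s
      using topological_tendstoD[OF Ya(2)[unfolded isCont_def] open_chart_dom[OF chart] Ya_dom]
        tendstoD[OF lim_a that] by eventually_elim (simp add: dist_norm)
    \<comment> \<open>the trajectory of \<open>y 0\<close> has deviation zero at time \<open>a\<close>, hence on the whole piece\<close>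
    have Y_eq: "Y \<tau> (y 0) = y \<tau>" if \<tau>: "\<tau> \<in> {a..b}" for \<tau>
    proof -
      obtain s where s: "s > 0" "\<And>x t. Y a x \<in> chart_dom c \<Longrightarrow> norm (coords c (Y a x) - g a) < s \<Longrightarrow> t \<in> {a..b} \<Longrightarrow>
        Y t x \<in> chart_dom c \<and> norm (coords c (Y t x) - g t) \<le> C * norm (coords c (Y a x) - g a)"
        using lin[of 1] by auto
      have "coords c (Y a (y 0)) - g a = 0" by (simp add: g_def Ya(1))
      then have "Y \<tau> (y 0) \<in> chart_dom c" "coords c (Y \<tau> (y 0)) = coords c (y \<tau>)"
        using s(2)[of "y 0" \<tau>] s(1) \<tau> Ya_dom by (auto simp: g_def)
      then show ?thesis
        using chart_inv_coords[OF chart] dom_ab[OF \<tau>] by metis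
    qed
    \<comment> \<open>deviations at time \<open>\<tau>\<close> are at most \<open>C\<close> times those at time \<open>a\<close>, which tend to zero\<close>
    have cont: "isCont (Y \<tau>) (y 0)" if \<tau>: "\<tau> \<in> {a..b}" for \<tau>
    proof -
      obtain s where s: "s > 0" "\<And>x t. Y a x \<in> chart_dom c \<Longrightarrow> norm (coords c (Y a x) - g a) < s \<Longrightarrow> t \<in> {a..b} \<Longrightarrow>
        Y t x \<in> chart_dom c \<and> norm (coords c (Y t x) - g t) \<le> C * norm (coords c (Y a x) - g a)"
        using lin[of 1] by auto
      have near: "\<forall>\<^sub>F x in at (y 0). Y \<tau> x \<in> chart_dom c \<and>
          norm (coords c (Y \<tau> x) - g \<tau>) \<le> C * norm (coords c (Y a x) - g a)"
        using near_a[OF s(1)] by eventually_elim (use s(2) \<tau> in blast)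
      have "((\<lambda>x. C * norm (coords c (Y a x) - g a)) \<longlongrightarrow> C * norm (g a - g a)) (at (y 0))"
        by (intro tendsto_intros lim_a)
      then have "((\<lambda>x. C * norm (coords c (Y a x) - g a)) \<longlongrightarrow> 0) (at (y 0))" by simp
      then have "((\<lambda>x. coords c (Y \<tau> x) - g \<tau>) \<longlongrightarrow> 0) (at (y 0))"
        by (rule Lim_null_comparison[rotated]) (use near in \<open>auto elim: eventually_mono\<close>)
      then have "((\<lambda>x. coords c (Y \<tau> x)) \<longlongrightarrow> g \<tau>) (at (y 0))" by (rule LIM_zero_cancel)
      then have "((\<lambda>x. chart_inv c (coords c (Y \<tau> x))) \<longlongrightarrow> chart_inv c (g \<tau>)) (at (y 0))"
        by (rule isCont_tendsto_compose[OF isCont_chart_inv[OF chart], rotated])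
          (simp add: g_def coords_in_img dom_ab[OF \<tau>])
      then have "(Y \<tau> \<longlongrightarrow> chart_inv c (g \<tau>)) (at (y 0))"
        by (rule Lim_transform_eventually)
          (use near in \<open>auto elim!: eventually_mono simp: chart_inv_coords[OF chart]\<close>)
      then show ?thesis
        using Y_eq[OF \<tau>] chart_inv_coords[OF chart dom_ab[OF \<tau>]] by (simp add: isCont_def g_def)
    qed
    have deriv: "((coords c \<circ> Y \<tau> \<circ> chart_inv c0) has_derivative
        (\<lambda>h. M \<tau> (frechet_derivative (coords c \<circ> Y a \<circ> chart_inv c0) (at (coords c0 (y 0))) h))) (at (coords c0 (y 0)))"
      if \<tau>: "\<tau> \<in> {a..b}" and c0: "c0 \<in> A" "y 0 \<in> chart_dom c0" for \<tau> c0
    proof (rule has_derivative_asymptotic[where M = "blinfun_apply (M \<tau>)"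
          and F = "coords c \<circ> Y a \<circ> chart_inv c0"])
      note chart0 = atlas_chart[OF atlas c0(1)]
      have p_eq: "chart_inv c0 (coords c0 (y 0)) = y 0" by (rule chart_inv_coords[OF chart0 c0(2)])
      show "((coords c \<circ> Y a \<circ> chart_inv c0) has_derivative
          frechet_derivative (coords c \<circ> Y a \<circ> chart_inv c0) (at (coords c0 (y 0)))) (at (coords c0 (y 0)))"
        using tr c0 c(1) Ya_dom unfolding tracks_def by (intro map_differentiable_atD) auto
      show "bounded_linear (blinfun_apply (M \<tau>))" by (rule blinfun.bounded_linear_right)
      fix e :: real assume e: "e > 0"
      \<comment> \<open>\<open>flow_linearisation\<close> yields the relative error \<open>\<epsilon> C\<^sup>2\<close>\<close>
      define \<epsilon> where "\<epsilon> = min 1 (e / C\<^sup>2)"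
      have \<epsilon>: "\<epsilon> > 0" "\<epsilon> \<le> 1" "\<epsilon> * C\<^sup>2 \<le> e"
        using e \<open>C > 0\<close> by (auto simp: \<epsilon>_def min_def field_simps)
      obtain s where s: "s > 0" "\<And>x t. Y a x \<in> chart_dom c \<Longrightarrow> norm (coords c (Y a x) - g a) < s \<Longrightarrow> t \<in> {a..b} \<Longrightarrow>
          norm (coords c (Y t x) - g t - M t (coords c (Y a x) - g a)) \<le> \<epsilon> * C\<^sup>2 * norm (coords c (Y a x) - g a)"
        using lin[OF \<epsilon>(1,2)] by auto
      have "isCont (\<lambda>\<xi>. Y a (chart_inv c0 \<xi>)) (coords c0 (y 0))"
        using Ya(2) p_eq by (intro isCont_o2[OF isCont_chart_inv[OF chart0 coords_in_img[OF c0(2)]]]) simp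
      then have lim: "(\<lambda>\<xi>. Y a (chart_inv c0 \<xi>)) \<midarrow>coords c0 (y 0)\<rightarrow> y a"
        by (simp add: isCont_def p_eq Ya(1))
      have lim': "(\<lambda>\<xi>. coords c (Y a (chart_inv c0 \<xi>))) \<midarrow>coords c0 (y 0)\<rightarrow> g a"
        unfolding g_def by (rule tendsto_coords[OF chart lim dom_ab[OF a_in]])
      from topological_tendstoD[OF lim open_chart_dom[OF chart] dom_ab[OF a_in]] tendstoD[OF lim' s(1)]
      show "\<forall>\<^sub>F \<xi> in at (coords c0 (y 0)).
          norm ((coords c \<circ> Y \<tau> \<circ> chart_inv c0) \<xi> - (coords c \<circ> Y \<tau> \<circ> chart_inv c0) (coords c0 (y 0))
            - M \<tau> ((coords c \<circ> Y a \<circ> chart_inv c0) \<xi> - (coords c \<circ> Y a \<circ> chart_inv c0) (coords c0 (y 0))))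
          \<le> e * norm ((coords c \<circ> Y a \<circ> chart_inv c0) \<xi> - (coords c \<circ> Y a \<circ> chart_inv c0) (coords c0 (y 0)))"
      proof eventually_elim
        case (elim \<xi>)
        have "norm (coords c (Y \<tau> (chart_inv c0 \<xi>)) - g \<tau> - M \<tau> (coords c (Y a (chart_inv c0 \<xi>)) - g a))
            \<le> \<epsilon> * C\<^sup>2 * norm (coords c (Y a (chart_inv c0 \<xi>)) - g a)"
          using elim \<tau> by (intro s(2)) (auto simp: dist_norm)
        also have "\<dots> \<le> e * norm (coords c (Y a (chart_inv c0 \<xi>)) - g a)"
          using \<epsilon>(3) by (rule mult_right_mono) simp
        finally show ?case by (simp add: p_eq Y_eq[OF \<tau>] Ya(1) g_def)
      qed
    qed
    show ?tracks
      unfolding tracks_def map_differentiable_at_def differentiable_def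
    proof (intro conjI ballI impI Y_eq[OF t] cont[OF t])
      fix c0 c' assume "c0 \<in> A" "c' \<in> A" "y 0 \<in> chart_dom c0" "Y t (y 0) \<in> chart_dom c'"
      then show "\<exists>D. ((coords c' \<circ> Y t \<circ> chart_inv c0) has_derivative D) (at (coords c0 (y 0)))"
        using change_target_chart[OF atlas _ c(1) _ _ _ _ cont[OF t] deriv[OF t]] Y_eq[OF t] dom_ab[OF t]
        by (metis (no_types, lifting))
    qed
    define c0 where "c0 = chart_at A (y 0)"
    note c0 = chart_at[OF atlas, of "y 0", folded c0_def]
    define w where "w = frechet_derivative (coords c \<circ> Y a \<circ> chart_inv c0) (at (coords c0 (y 0))) (v c0)"
    have diff: "differential A (Y \<tau>) (y 0) v c = M \<tau> w" if \<tau>: "\<tau> \<in> {a..b}" for \<tau>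
      unfolding w_def c0_def
      by (rule differential_apply[OF c(1) _ deriv[OF \<tau> c0, unfolded c0_def]])
        (simp add: Y_eq[OF \<tau>] dom_ab[OF \<tau>])
    have "((\<lambda>\<tau>. M \<tau> w) has_vector_derivative (transport_generator \<Gamma> c y t o\<^sub>L M t) w) (at t within {a..b})"
      using bounded_linear.has_vector_derivative[OF blinfun.bounded_linear_left M[OF t]] .
    then show ?deriv
      unfolding diff[OF t] by (intro has_vector_derivative_transform[OF t diff]) simp_all
  qed
  show thesis
    by (rule that[OF d(1)]) (use main in blast)+
qed

lemma tracks_everywhere:
  assumes t: "t \<in> {0..1}" shows "tracks t"
proof -
  define P where "P a b \<longleftrightarrow> (0 \<le> a \<and> a \<le> b \<and> b \<le> 1 \<longrightarrow> tracks a \<longrightarrow> tracks b)" for a b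
  have "Y 0 = (\<lambda>x. x)" using flow_0 by auto
  then have "tracks 0"
    unfolding tracks_def using map_differentiable_at_id[OF atlas, of "y 0"] by simp
  have "0 \<le> t" using t by simp
  then have "P 0 t"
  proof (induction rule: Bolzano)
    case (trans a b c)
    then show ?case unfolding P_def by auto
  next
    case (local x)
    have x: "x \<in> {0..1}" using local t by simp
    obtain d where d: "d > 0"
      "\<And>a b t. {a..b} \<subseteq> {0..1} \<inter> cball x d \<Longrightarrow> tracks a \<Longrightarrow> t \<in> {a..b} \<Longrightarrow> tracks t"
      by (rule tracks_locally[OF x chart_at[OF atlas]]) blast
    show ?case
    proof (intro exI[of _ d] conjI allI impI d(1))
      fix a b assume ab: "a \<le> x \<and> x \<le> b \<and> b - a < d"
      show "P a b" unfolding P_def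
      proof (intro impI)
        assume range: "0 \<le> a \<and> a \<le> b \<and> b \<le> 1" and "tracks a"
        moreover have "{a..b} \<subseteq> {0..1} \<inter> cball x d" using ab range by (auto simp: dist_real_def)
        ultimately show "tracks b" using d(2)[of a b b] by simp
      qed
    qed
  qed
  then show ?thesis using \<open>tracks 0\<close> t by (simp add: P_def)
qed

text \<open>For every time and every chart around the point of the path, the local statement is applied to an
  interval that is a neighbourhood of this time in \<open>{0..t}\<close>; its left end is tracked, as all times
  are.\<close>
lemma differential_parallel:
  assumes t: "t \<in> {0..1}"
  shows "parallel_along A \<Gamma> y t (\<lambda>\<tau>. differential A (Y \<tau>) (y 0) v)"
  unfolding parallel_along_iff
proof (intro conjI ballI impI)
  fix \<tau> assume \<tau>: "\<tau> \<in> {0..t}"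
  then have \<tau>01: "\<tau> \<in> {0..1}" using t by simp
  from tracks_everywhere[OF this] show "differential A (Y \<tau>) (y 0) v \<in> tangent_space A (y \<tau>)"
    unfolding tracks_def using differential_in_tangent_space[OF atlas, of "Y \<tau>" "y 0" v] by auto
  fix c assume c: "c \<in> A" "y \<tau> \<in> chart_dom c"
  obtain d where d: "d > 0"
    "\<And>a b t. {a..b} \<subseteq> {0..1} \<inter> cball \<tau> d \<Longrightarrow> tracks a \<Longrightarrow> t \<in> {a..b} \<Longrightarrow>
      ((\<lambda>\<tau>. differential A (Y \<tau>) (y 0) v c) has_vector_derivative
        transport_generator \<Gamma> c y t (differential A (Y t) (y 0) v c)) (at t within {a..b})"
    by (rule tracks_locally[OF \<tau>01 c]) blast
  define a where "a = max 0 (\<tau> - d)"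
  define b where "b = min t (\<tau> + d)"
  have ab: "{a..b} \<subseteq> {0..1} \<inter> cball \<tau> d" "\<tau> \<in> {a..b}" "a \<in> {0..1}"
    using \<tau> t d(1) by (auto simp: a_def b_def dist_real_def)
  have "((\<lambda>\<tau>. differential A (Y \<tau>) (y 0) v c) has_vector_derivative
      transport_generator \<Gamma> c y \<tau> (differential A (Y \<tau>) (y 0) v c)) (at \<tau> within {a..b})"
    by (rule d(2)[OF ab(1) tracks_everywhere[OF ab(3)] ab(2)])
  moreover have "at \<tau> within {a..b} = at \<tau> within {0..t}"
    using d(1) by (intro at_within_nhd[of _ "ball \<tau> d"]) (auto simp: a_def b_def dist_real_def)
  ultimately show "((\<lambda>\<tau>. differential A (Y \<tau>) (y 0) v c) has_vector_derivative
      transport_generator \<Gamma> c y \<tau> (differential A (Y \<tau>) (y 0) v c)) (at \<tau> within {0..t})" by simp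
qed

lemma differential_eq_parallel_translation:
  assumes t: "t \<in> {0..1}" and v: "v \<in> tangent_space A (y 0)"
  shows "differential A (Y t) (y 0) v = parallel_translation A \<Gamma> y t v"
proof -
  have "Y 0 = (\<lambda>x. x)" using flow_0 by auto
  then have init: "differential A (Y 0) (y 0) v = v" using differential_id[OF atlas v] by simp
  show ?thesis
    unfolding parallel_translation_def
  proof (rule the_equality[symmetric])
    show "\<exists>W. parallel_along A \<Gamma> y t W \<and> W 0 = v \<and> W t = differential A (Y t) (y 0) v"
      using differential_parallel[OF t, of v] init by blast
    show "w = differential A (Y t) (y 0) v"
      if "\<exists>W. parallel_along A \<Gamma> y t W \<and> W 0 = v \<and> W t = w" for w
      using that parallel_along_unique[OF atlas connection(1) path t _ differential_parallel[OF t, of v]] init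
      by metis
  qed
qed

end

theorem theorem3p1:
  fixes A :: "('m::{t2_space,second_countable_topology}, 'd::finite) chart set"
    and \<omega> :: "('m, 'd) tensor2" and \<Gamma> :: "('m, 'd) christoffel" and H :: "('m, 'd) fun_form"
    and n :: nat and y :: "real \<Rightarrow> 'm" and Y :: "real \<Rightarrow> 'm \<Rightarrow> 'm"
  assumes "smooth_atlas A" and "CARD('d) = 2 * n"
    and "symplectic_form A \<omega>"
    and "affine_connection A \<Gamma>" and "torsion_free A \<Gamma>" and "parallel_form A \<Gamma> \<omega>"
    and "ether_hamiltonian A \<omega> \<Gamma> H"
    and "smooth_path A y"
    and "translation_flow A \<omega> H y Y"
  shows "\<forall>t\<in>{0..1}. Y t (y 0) = y t \<and>
    map_differentiable_at A (Y t) (y 0) \<and>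
    (\<forall>v\<in>tangent_space A (y 0). differential A (Y t) (y 0) v = parallel_translation A \<Gamma> y t v)"
proof -
  interpret ether_flow A \<omega> \<Gamma> H y Y
    by unfold_locales (use assms in \<open>auto simp: ether_hamiltonian_def\<close>)
  show ?thesis
    using tracks_everywhere differential_eq_parallel_translation unfolding tracks_def by blast
qed

end
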